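(* Let $F$ be a field of characteristic $p>0$. Let $f$ be a normal polynomial in $F[x]$ of degree $p^2$ with $f'\neq 0$ and with at least two normal decompositions. Then exactly one of the following statements holds: (i) There is $w\in F$ and a positive divisor $m$ of $p-1$ such that for each normal decomposition $(g,h)$ of $(x-f(w))\circ f\circ(x+w)$ there are $a$ and $b$ in $F^\times$ such that $g=x(x^\ell-a)^m$ and $h=x(x^\ell-b)^m$ with $\ell=(p-1)/m$. (ii) There is $w\in F$ and an integer $1<m<p-1$ such that for each normal decomposition $(g,h)$ of $(x-f(w))\circ f\circ(x+w)$ there are $r\in\{m,p-m\}$ and $a,b\in F^\times$ such that $g=x^r(x-a)^{p-r}$, $h=x^{p-r}q$, and $h-a=(x-b)^r\tilde q$, where $q$ and $\tilde q$ are squarefree polynomials of degree $r$ and $p-r$, respectively.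
   Context: A polynomial is normal if it is monic and has zero constant term. A decomposition of a polynomial $f\in F[x]$ is a pair $(g,h)$ of polynomials in $F[x]$, both of degree at least two, with $f=g\circ h$; it is normal if $g$ and $h$ are both normal. $\circ$ denotes functional composition, so $(x-f(w))\circ f\circ (x+w)=f(x+w)-f(w)$. *)

theory Defs
  imports "HOL-Computational_Algebra.Computational_Algebra"
begin

definition normal_poly :: "'a::field poly \<Rightarrow> bool" where
  "normal_poly f \<longleftrightarrow> lead_coeff f = 1 \<and> coeff f 0 = 0"

definition decomposition :: "'a::field poly \<Rightarrow> 'a poly \<times> 'a poly \<Rightarrow> bool" where
  "decomposition f d \<longleftrightarrow>
     degree (fst d) \<ge> 2 \<and> degree (snd d) \<ge> 2 \<and> f = pcompose (fst d) (snd d)"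

definition normal_decomposition :: "'a::field poly \<Rightarrow> 'a poly \<times> 'a poly \<Rightarrow> bool" where
  "normal_decomposition f d \<longleftrightarrow>
     decomposition f d \<and> normal_poly (fst d) \<and> normal_poly (snd d)"

text \<open>The polynomial \<open>(x - f(w)) \<circ> f \<circ> (x + w)\<close>, that is, \<open>f(x + w) - f(w)\<close>.\<close>

definition shift_poly :: "'a::field \<Rightarrow> 'a poly \<Rightarrow> 'a poly" where
  "shift_poly w f = pcompose [:- poly f w, 1:] (pcompose f [:w, 1:])"

end

theory Submission
  imports "HOL-Algebra.Algebraic_Closure_Type" Defs
begin

text \<open>
  Let \<open>f = g \<circ> h = g\<^sup>* \<circ> h\<^sup>*\<close> be two different normal decompositions. Comparing degrees modulo \<open>p\<close> in
  \<open>(h - h\<^sup>*)\<^sup>p = h\<^sup>p - h\<^sup>*\<^sup>p\<close> shows that \<open>g'\<close>, \<open>h'\<close>, \<open>g\<^sup>*'\<close>, \<open>h\<^sup>*'\<close> have the same degree \<open>r - 1\<close> and that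
  \<open>h - h\<^sup>*\<close> has degree \<open>r < p\<close>. Since \<open>r\<close> is prime to \<open>p\<close>, the curve \<open>g(y) = g\<^sup>*(z)\<close> is parametrized
  generically one-to-one by \<open>(h, h\<^sup>*)\<close>, so over an algebraic closure the multiplicities of \<open>h\<close> at
  the points over \<open>(b, z)\<close> add up to the multiplicity of \<open>g\<^sup>*\<close> at \<open>z\<close>. All multiplicities are
  smaller than \<open>p\<close>, and the ramification forced on \<open>h\<close> by that of \<open>g\<^sup>*\<close> already exhausts
  \<open>deg h' = deg g\<^sup>*'\<close>. This leaves a single critical value of \<open>f\<close>, over which \<open>g\<close> and \<open>g\<^sup>*\<close> have one
  point of multiplicity \<open>u\<close> and all others of multiplicity \<open>M > u\<close>, where \<open>u = 1\<close> (case (i)) or \<open>p = u + M\<close>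
  (case (ii)). If \<open>g'\<close> is constant, the components are additive, which is case (i) with \<open>m = 1\<close>.
\<close>

section \<open>Degrees of the components of a collision\<close>

text \<open>Two demands shape the proof beyond the ramification analysis: one \<open>w\<close> must
  serve every normal decomposition, and \<open>w\<close>, \<open>a\<close>, \<open>b\<close> must
  lie in \<open>F\<close>, which need not be perfect. For the first, \<open>w\<close> is pinned down
  by \<open>f\<close> alone: over the only critical value, \<open>f\<close> has multiplicity 1 at
  \<open>w\<close> in case (i) and \<open>u * M\<close> in case (ii). In case (ii) two points
  qualify, and their roles may be exchanged from one decomposition to another; hence the choice
  between m and p - m. For the second, if Z over \<open>F\<close> has degree N, nonzero in
  \<open>F\<close>, then Z(x + w) has second coefficient z' + N*w*z, where z is the leading and z'
  the second coefficient of Z. Once that coefficient is known to lie in \<open>F\<close>, so does w.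
  Z is a derivative of a component or a gcd with such a derivative, all of degree below p. The curve
  is handled in the coordinates \<open>h\<close> and \<open>hs - h\<close>: \<open>h\<close> and
  \<open>hs\<close> have equal degree, whereas p and r are coprime, so the powers of
  \<open>hs - h\<close> below the p-th have distinct degrees modulo p. The cases exclude each other
  because g' has two distinct roots in (ii), while in (i) a derivative of that degree is a power of
  one linear factor.\<close>

lemma of_nat_neq_0_less_CHAR: "0 < i \<Longrightarrow> i < CHAR('a::semiring_1) \<Longrightarrow> of_nat i \<noteq> (0::'a)"
  by (auto simp: of_nat_eq_0_iff_char_dvd dest: dvd_imp_le)

lemma degree_pderiv_eq:
  fixes G :: "'a::idom poly"
  assumes "of_nat (degree G) \<noteq> (0::'a)"
  shows "degree (pderiv G) = degree G - 1"
proof (rule antisym)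
  show "degree (pderiv G) \<le> degree G - 1"
    by (rule degree_le) (auto simp: coeff_pderiv coeff_eq_0)
  have "G \<noteq> 0" "degree G \<noteq> 0" using assms by (auto intro: ccontr)
  then have "coeff (pderiv G) (degree G - 1) \<noteq> 0"
    using assms by (simp add: coeff_pderiv)
  then show "degree G - 1 \<le> degree (pderiv G)" by (rule le_degree)
qed

lemma pcompose_eq_sum:
  "pcompose G u = (\<Sum>i\<le>degree G. smult (coeff G i) (u ^ i))" for G :: "'a::comm_ring_1 poly"
proof -
  have m: "pcompose (monom c n) u = smult c (u ^ n)" for c :: 'a and n
    by (induction n) (simp_all add: monom_0 monom_Suc pcompose_pCons)
  have "pcompose G u = pcompose (\<Sum>i\<le>degree G. monom (coeff G i) i) u"
    by (simp add: poly_as_sum_of_monoms)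
  then show ?thesis by (simp add: pcompose_sum m)
qed

text \<open>The cofactor of \<open>u - v\<close> is a sum of \<open>i\<close> monic products of
  degree \<open>p * (i - 1)\<close>, so its top coefficient is \<open>i\<close>, which is nonzero by
  assumption.\<close>

lemma degree_power_diff:
  fixes u v :: "'a::idom poly"
  assumes u: "lead_coeff u = 1" "degree u = p" and v: "lead_coeff v = 1" "degree v = p"
    and ne: "u \<noteq> v" and i: "of_nat i \<noteq> (0::'a)"
  shows "degree (u ^ i - v ^ i) = degree (u - v) + p * (i - 1)"
proof -
  define S where "S = (\<Sum>j<i. v ^ (i - Suc j) * u ^ j)"
  have uv: "u \<noteq> 0" "v \<noteq> 0" using u v by auto
  have dt: "degree (v ^ (i - Suc j) * u ^ j) = p * (i - 1)" if "j < i" for j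
  proof -
    have "degree (v ^ (i - Suc j) * u ^ j) = (i - Suc j) * p + j * p"
      using uv u v by (simp add: degree_mult_eq degree_power_eq)
    also have "\<dots> = ((i - Suc j) + j) * p" by (simp only: add_mult_distrib)
    also have "(i - Suc j) + j = i - 1" using that by simp
    finally show ?thesis by (simp only: mult.commute)
  qed
  have lt: "coeff (v ^ (i - Suc j) * u ^ j) (p * (i - 1)) = 1" if "j < i" for j
    using dt[OF that] u v by (metis lead_coeff_mult lead_coeff_power mult_1 power_one)
  have "coeff S (p * (i - 1)) = of_nat i"
    unfolding S_def coeff_sum using lt by simp
  then have "p * (i - 1) \<le> degree S" using i by (intro le_degree) simp
  moreover have "degree S \<le> p * (i - 1)"
    unfolding S_def by (rule degree_sum_le) (simp_all add: dt del: One_nat_def)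
  ultimately have dS: "degree S = p * (i - 1)" by simp
  have S0: "S \<noteq> 0" using \<open>coeff S _ = of_nat i\<close> i by auto
  have "u ^ i - v ^ i = (u - v) * S" unfolding S_def by (rule power_diff_sumr2)
  then show ?thesis using S0 ne dS by (simp add: degree_mult_eq)
qed

text \<open>Each step down in the exponent costs \<open>p\<close> in degree, so the top power of
  \<open>G\<close> decides. The result is congruent to \<open>degree (u - v)\<close> modulo
  \<open>p\<close>, whereas anything composed with a polynomial of degree \<open>p\<close> has
  degree divisible by \<open>p\<close>; this contrast drives the degree comparison for
  collisions.\<close>

lemma degree_pcompose_diff:
  fixes G u v :: "'a::idom poly"
  assumes u: "lead_coeff u = 1" "degree u = p" and v: "lead_coeff v = 1" "degree v = p"
    and k: "degree (u - v) > 0" and p: "p > 0"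
    and r: "\<And>i. 0 < i \<Longrightarrow> i \<le> degree G \<Longrightarrow> of_nat i \<noteq> (0::'a)" "degree G > 0"
  shows "degree (pcompose G u - pcompose G v) = degree (u - v) + p * (degree G - 1)"
proof -
  let ?n = "degree (u - v) + p * (degree G - 1)"
  let ?t = "\<lambda>i. smult (coeff G i) (u ^ i - v ^ i)"
  have ne: "u \<noteq> v" using k by auto
  have "pcompose G u - pcompose G v = (\<Sum>i\<le>degree G. ?t i)"
    by (simp add: pcompose_eq_sum sum_subtractf smult_diff_right)
  also have "\<dots> = (\<Sum>i<degree G. ?t i) + ?t (degree G)"
    by (simp add: lessThan_Suc_atMost[symmetric])
  finally have eq: "pcompose G u - pcompose G v = (\<Sum>i<degree G. ?t i) + ?t (degree G)" .
  have "degree (\<Sum>i<degree G. ?t i) < ?n"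
  proof (rule degree_sum_less)
    fix i assume i: "i \<in> {..<degree G}"
    show "degree (?t i) < ?n"
    proof (cases "i = 0")
      case True then show ?thesis using k by simp
    next
      case False
      have "degree (?t i) \<le> degree (u - v) + p * (i - 1)"
        using degree_power_diff[OF u v ne, of i] r(1)[of i] False i degree_smult_le[of "coeff G i" "u^i - v^i"] by auto
      also have "\<dots> < ?n" using i p False by auto
      finally show ?thesis .
    qed
  qed (use k in simp)
  moreover have "degree (?t (degree G)) = ?n"
  proof -
    have "G \<noteq> 0" using r(2) by auto
    then show ?thesis using degree_power_diff[OF u v ne, of "degree G"] r by simp
  qed
  ultimately show ?thesis unfolding eq by (simp add: degree_add_eq_right)
qed

lemma power_CHAR_poly:
  fixes d :: "'a::field poly"
  assumes "prime p" "CHAR('a) = p"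
  shows "d ^ p = pcompose (map_poly (\<lambda>a. a ^ p) d) (monom 1 p)"
proof (induction d rule: pCons_induct)
  case 0
  then show ?case using assms prime_gt_0_nat by (simp add: power_0_left)
next
  case (pCons a q)
  have ch: "CHAR('a poly) = p" using assms by simp
  have p0: "(0::'a) ^ p = 0" using assms prime_gt_0_nat by (simp add: power_0_left)
  have "(pCons a q) ^ p = ([:a:] + [:0,1:] * q) ^ p" by simp
  also have "\<dots> = [:a:] ^ p + ([:0,1:] * q) ^ p"
    by (rule freshmans_dream) (use assms ch in auto)
  also have "\<dots> = [:a ^ p:] + monom 1 p * q ^ p"
    by (simp add: poly_const_pow power_mult_distrib monom_altdef del: mult_pCons_left)
  finally show ?case using pCons p0 by (simp add: map_poly_pCons pcompose_pCons)
qed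

lemma pderiv_monom_CHAR: "pderiv (monom c CHAR('a)) = (0::'a::idom poly)"
  by (simp add: pderiv_monom)

text \<open>The p-th power of x has derivative zero, so the difference keeps the derivative of
  \<open>P\<close>; its degree is below \<open>p\<close> and therefore drops by exactly one under
  differentiation.\<close>

lemma monic_minus_monom:
  fixes P :: "'a::field poly"
  assumes "prime p" "CHAR('a) = p" "lead_coeff P = 1" "degree P = p" "pderiv P \<noteq> 0"
  shows "degree (P - monom 1 p) = degree (pderiv P) + 1" "degree (P - monom 1 p) < p"
proof -
  let ?G = "P - monom 1 p"
  have p0: "p > 0" using assms prime_gt_0_nat by simp
  have d: "pderiv ?G = pderiv P"
    using pderiv_monom_CHAR[where 'a='a, of 1] assms by (simp add: pderiv_diff)
  show lt: "degree ?G < p"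
  proof -
    have "degree ?G \<le> p" using assms by (intro degree_diff_le) (auto simp: degree_monom_eq)
    moreover have "coeff ?G p = 0" using assms by simp
    ultimately show ?thesis
      by (metis p0 degree_0 leading_coeff_0_iff le_neq_implies_less)
  qed
  have pos: "degree ?G > 0"
  proof (rule ccontr)
    assume "\<not> ?thesis"
    then have "pderiv ?G = 0" by (auto elim: degree_eq_zeroE)
    then show False using d assms by simp
  qed
  show "degree ?G = degree (pderiv P) + 1"
    using degree_pderiv_eq[of ?G] of_nat_neq_0_less_CHAR[where 'a='a, of "degree ?G"] pos lt assms d by auto
qed

lemma degree_pderiv_monic_less:
  fixes P :: "'a::field poly"
  assumes "prime p" "CHAR('a) = p" "lead_coeff P = 1" "degree P = p"
  shows "degree (pderiv P) < p - 1"
  using monic_minus_monom[OF assms] assms prime_gt_1_nat[of p] by (cases "pderiv P = 0") auto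

lemma degree_cancel:
  fixes A B C :: "'a::ring_1 poly"
  assumes "A = B + C" "degree C \<noteq> degree A"
  shows "degree B = max (degree A) (degree C)"
proof -
  have "B = A + - C" using assms by simp
  then show ?thesis using assms(2) degree_add_eq_left[of "-C" A] degree_add_eq_right[of A "-C"]
    by (cases "degree C < degree A") (auto simp del: add_uminus_conv_diff)
qed

lemma degree_pderiv_pcompose:
  fixes g h :: "'a::field poly"
  assumes "pderiv (pcompose g h) \<noteq> 0"
  shows "degree (pderiv (pcompose g h)) = degree (pderiv g) * degree h + degree (pderiv h)"
  using assms unfolding pderiv_pcompose by (subst degree_mult_eq) (auto simp: degree_pcompose)

text \<open>Writing both left components as x^p plus a remainder turns the collision into an
  identity for \<open>d ^ p\<close>. Its terms have degree 0, \<open>k\<close> or \<open>s\<close>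
  modulo \<open>p\<close>, and terms of different residue cannot cancel at the top.\<close>

theorem collision_degrees:
  fixes g h gs hs :: "'a::field poly"
  assumes p: "prime p" "CHAR('a) = p"
    and g: "lead_coeff g = 1" "degree g = p" and h: "lead_coeff h = 1" "degree h = p" "coeff h 0 = 0"
    and gs: "lead_coeff gs = 1" "degree gs = p" and hs: "lead_coeff hs = 1" "degree hs = p" "coeff hs 0 = 0"
    and eq: "pcompose g h = pcompose gs hs" and ne: "h \<noteq> hs" and der: "pderiv (pcompose g h) \<noteq> 0"
  shows "degree (pderiv gs) = degree (pderiv g)" "degree (pderiv h) = degree (pderiv g)"
    "degree (pderiv hs) = degree (pderiv g)" "degree (hs - h) = degree (pderiv g) + 1"
proof -
  have p1: "p > 1" using p prime_gt_1_nat by simp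
  have nz: "pderiv g \<noteq> 0" "pderiv h \<noteq> 0" "pderiv gs \<noteq> 0" "pderiv hs \<noteq> 0"
    using der by (auto simp: pderiv_pcompose) (use der eq in \<open>auto simp: pderiv_pcompose\<close>)
  have lt: "degree (pderiv h) < p" "degree (pderiv hs) < p"
    using degree_pderiv_monic_less[OF p h(1,2)] degree_pderiv_monic_less[OF p hs(1,2)] by auto
  \<comment> \<open>The derivatives of the right components have degree below \<open>p\<close>, so
    both sides are expansions to base \<open>p\<close> and their digits agree.\<close>
  have "degree (pderiv g) * p + degree (pderiv h) = degree (pderiv gs) * p + degree (pderiv hs)"
    using degree_pderiv_pcompose[OF der] degree_pderiv_pcompose[of gs hs] der eq h hs by simp
  then have "degree (pderiv g) = degree (pderiv gs) \<and> degree (pderiv h) = degree (pderiv hs)"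
    using lt by (metis add.commute div_mult_self1_is_m add_right_cancel div_mult_self3 div_less
        add_0 gr_implies_not0 div_mult_self1)
  then have sm: "degree (pderiv gs) = degree (pderiv g)" "degree (pderiv hs) = degree (pderiv h)" by auto
  define G Gs where "G = g - monom 1 p" and "Gs = gs - monom 1 p"
  define r where "r = degree G"
  have r: "r = degree (pderiv g) + 1" "r < p" "degree Gs = r"
    using monic_minus_monom[OF p g nz(1)] monic_minus_monom[OF p gs nz(3)] sm
    by (auto simp: G_def Gs_def r_def)
  define s where "s = degree (h - monom 1 p)"
  have s: "s = degree (pderiv h) + 1" "s < p"
    using monic_minus_monom[OF p h(1,2) nz(2)] by (auto simp: s_def)
  define d where "d = h - hs"
  define k where "k = degree d"
  have d0: "d \<noteq> 0" using ne by (simp add: d_def)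
  have k: "0 < k" "k < p"
  proof -
    show "0 < k"
    proof (rule ccontr)
      assume "\<not> 0 < k"
      then obtain c where "d = [:c:]" unfolding k_def by (auto elim: degree_eq_zeroE)
      then have "d = [:coeff d 0:]" by simp
      also have "coeff d 0 = 0" using h hs by (simp add: d_def)
      finally show False using d0 by simp
    qed
    have "degree d \<le> p" using h hs unfolding d_def by (intro degree_diff_le) auto
    moreover have "coeff d p = 0" using h hs by (simp add: d_def)
    ultimately show "k < p"
      using p1 unfolding k_def by (metis degree_0 leading_coeff_0_iff le_neq_implies_less gr_implies_not0 neq0_conv)
  qed
  have nat0: "of_nat i \<noteq> (0::'a)" if "0 < i" "i \<le> r" for i
    using of_nat_neq_0_less_CHAR[where 'a='a, of i] that r p by simp
  have nmult: "m * p \<noteq> a + p * b" if "0 < a" "a < p" for a b m :: nat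
  proof
    assume "m * p = a + p * b"
    then have "(m * p) mod p = (a + p * b) mod p" by (rule arg_cong)
    then show False using that by simp
  qed
  have x: "lead_coeff (monom 1 p :: 'a poly) = 1" "degree (monom 1 p :: 'a poly) = p"
    by (auto simp: degree_monom_eq)
  have dp: "d ^ p = h ^ p - hs ^ p"
  proof -
    have "h ^ p = (d + hs) ^ p" by (simp add: d_def)
    also have "\<dots> = d ^ p + hs ^ p" by (rule freshmans_dream) (use p in auto)
    finally show ?thesis by simp
  qed
  have mono: "pcompose (monom 1 p) u = u ^ p" for u :: "'a poly"
    by (simp add: pcompose_eq_sum degree_monom_eq if_distrib[of "\<lambda>c. smult c _"] cong: if_cong)
  define D where "D = Gs - G"
  have gG: "pcompose g u = u ^ p + pcompose G u" "pcompose gs u = u ^ p + pcompose Gs u" for u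
    unfolding G_def Gs_def pcompose_diff mono by auto
  have base: "d ^ p = pcompose Gs hs - pcompose G h"
    using eq unfolding gG dp by (simp add: algebra_simps)
  have dk: "degree (pcompose Gs hs - pcompose Gs h) = k + p * (r - 1)"
    using degree_pcompose_diff[OF hs(1,2) h(1,2), of Gs] k p1 nat0 r
    by (simp add: k_def d_def degree_minus[of "h - hs", symmetric] del: degree_minus)
  have dk': "degree (pcompose G hs - pcompose G h) = k + p * (r - 1)"
    using degree_pcompose_diff[OF hs(1,2) h(1,2), of G] k p1 nat0 r
    by (simp add: k_def d_def r_def degree_minus[of "h - hs", symmetric] del: degree_minus)
  have degdp: "degree (d ^ p) = k * p" using d0 by (simp add: degree_power_eq k_def)
  have "k = r \<and> degree D = r"
  proof -
    \<comment> \<open>The first summand has degree divisible by \<open>p\<close>, the bracket has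
      degree \<open>k + p * (r - 1)\<close> with 0 < k < p. So the bracket is not on top,
      \<open>k * p\<close> exceeds its degree, and r - 1 < k = deg D \<le> r follows.\<close>
    have A: "d ^ p = pcompose D hs + (pcompose G hs - pcompose G h)"
      unfolding base D_def pcompose_diff by simp
    have "degree (pcompose D hs) = max (k * p) (k + p * (r - 1))"
      using degree_cancel[OF A] degdp dk' nmult[of k k "r - 1"] k by simp
    then have e: "degree D * p = max (k * p) (k + p * (r - 1))" by (simp add: degree_pcompose hs)
    then have "degree D * p = k * p" and le: "k + p * (r - 1) < k * p"
      using nmult[of k "degree D" "r - 1"] k nmult[of k k "r-1"] by (auto simp: max_def split: if_splits)
    then have "degree D = k" using p1 by simp
    moreover have "degree D \<le> r" unfolding D_def using r r_def by (intro degree_diff_le) auto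
    moreover have "r \<le> k"
    proof -
      have "p * (r - 1) < p * k" using le unfolding mult.commute[of k p] by linarith
      then have "r - 1 < k" by (rule mult_less_cancel1[THEN iffD1, THEN conjunct2])
      then show ?thesis by simp
    qed
    ultimately show ?thesis by simp
  qed
  then have kr: "k = r" and Dr: "degree D = r" by auto
  have "s = r"
  proof (rule ccontr)
    assume sr: "s \<noteq> r"
    \<comment> \<open>Since \<open>d ^ p\<close> is itself a polynomial in x^p, subtracting D(x^p)
      leaves something of degree divisible by \<open>p\<close>. The two brackets on the other side
      have residues \<open>s\<close> and \<open>k = r\<close>, both nonzero, and could cancel at the
      top only if these agree.\<close>
    define Q where "Q = map_poly (\<lambda>a. a ^ p) d - D"
    have "pcompose Q (monom 1 p) = d ^ p - pcompose D (monom 1 p)"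
      unfolding Q_def pcompose_diff using power_CHAR_poly[OF p, of d] by simp
    also have "\<dots> = (pcompose D h - pcompose D (monom 1 p)) + (pcompose Gs hs - pcompose Gs h)"
      unfolding base D_def pcompose_diff by simp
    finally have A: "pcompose Q (monom 1 p) = (pcompose D h - pcompose D (monom 1 p)) + (pcompose Gs hs - pcompose Gs h)" .
    have dQ: "degree (pcompose Q (monom 1 p)) = degree Q * p" by (simp add: degree_pcompose degree_monom_eq)
    have dD: "degree (pcompose D h - pcompose D (monom 1 p)) = s + p * (r - 1)"
      using degree_pcompose_diff[OF h(1,2) x, of D] s p1 nat0 r Dr by (simp add: s_def)
    have "s + p * (r - 1) = max (degree Q * p) (k + p * (r - 1))"
      using degree_cancel[OF A] dQ dD dk nmult[of k "degree Q" "r - 1"] k by simp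
    then show False using sr kr nmult[of s "degree Q" "r - 1"] s by (auto simp: max_def split: if_splits)
  qed
  then show "degree (pderiv h) = degree (pderiv g)" using r s by simp
  then show "degree (pderiv gs) = degree (pderiv g)" "degree (pderiv hs) = degree (pderiv g)" using sm by auto
  show "degree (hs - h) = degree (pderiv g) + 1"
    using kr r degree_minus[of d] by (simp add: k_def d_def)
qed

section \<open>The fibre product of two decompositions\<close>

lemma prod_linear_mset_neq_0: "(\<Prod>x\<in>#A. [:- f x, 1::'a::idom:]) \<noteq> 0"
  by (auto simp: prod_mset_zero_iff)

lemma proots_prod_linear_mset: "proots (\<Prod>x\<in>#A. [:- f x, 1::'a::idom:]) = image_mset f A"
proof (induction A)
  case (add x A)
  have "proots ([:- f x, 1:] * (\<Prod>x\<in>#A. [:- f x, 1:])) = proots [:- f x, 1:] + proots (\<Prod>x\<in>#A. [:- f x, 1:])"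
    by (rule proots_mult) (use prod_linear_mset_neq_0 in auto)
  then show ?case using add by (simp del: mult_pCons_left)
qed simp

lemma alg_closed_proots:
  fixes P :: "'a::alg_closed_field poly"
  assumes "P \<noteq> 0"
  shows "size (proots P) = degree P"
    and "P = smult (lead_coeff P) (\<Prod>x\<in>#proots P. [:- x, 1:])"
proof -
  obtain A where A: "size A = degree P" "P = smult (lead_coeff P) (\<Prod>x\<in>#A. [:- x, 1:])"
    using alg_closed_imp_factorization[OF assms] by blast
  have "proots P = proots (\<Prod>x\<in>#A. [:- x, 1:])"
    using A(2) assms proots_smult by (metis leading_coeff_0_iff)
  also have "\<dots> = A" using proots_prod_linear_mset[of "\<lambda>x. x"] by simp
  finally show "size (proots P) = degree P" "P = smult (lead_coeff P) (\<Prod>x\<in>#proots P. [:- x, 1:])"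
    using A by auto
qed

lemma infinite_UNIV_alg_closed: "infinite (UNIV :: 'a::alg_closed_field set)"
proof
  assume fin: "finite (UNIV :: 'a set)"
  define P where "P = 1 + (\<Prod>a\<in>(UNIV :: 'a set). [:- a, 1:])"
  have dQ: "degree (\<Prod>a\<in>(UNIV :: 'a set). [:- a, 1:]) = card (UNIV :: 'a set)"
    by (subst degree_prod_eq_sum_degree) auto
  have "card (UNIV :: 'a set) > 0" using fin by (simp add: finite_UNIV_card_ge_0)
  then have "degree P > 0" unfolding P_def using dQ by (subst degree_add_eq_right) auto
  then obtain x where "poly P x = 0" using alg_closed_imp_poly_has_root by blast
  moreover have "poly P x = 1" using fin by (auto simp: P_def poly_prod prod_zero_iff)
  ultimately show False by simp
qed

lemma alg_closed_poly_eqI: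
  fixes P Q :: "'a::alg_closed_field poly"
  assumes "\<And>x. poly P x = poly Q x"
  shows "P = Q"
proof (rule ccontr)
  assume "P \<noteq> Q"
  then have "finite {x. poly (P - Q) x = 0}" by (intro poly_roots_finite) auto
  then show False using infinite_UNIV_alg_closed[where 'a='a] assms by simp
qed

text \<open>Swapping the two factors of the double product over the roots of \<open>h - b\<close> and of \<open>u\<close>
  exhibits the norm of \<open>u\<close> as a polynomial in \<open>b\<close>.\<close>

lemma prod_over_fibre_is_poly:
  fixes h u :: "'a::alg_closed_field poly"
  assumes h: "lead_coeff h = 1" "degree h > 0" and u: "u \<noteq> 0"
  shows "\<exists>q. \<forall>b. (\<Prod>\<alpha>\<in>#proots (h - [:b:]). poly u \<alpha>) = poly q b"
proof -
  define n where "n = degree h"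
  define c where "c = lead_coeff u"
  \<comment> \<open>The product of \<gamma> - \<alpha> over the roots \<alpha> of
    \<open>h - b\<close> is h(\<gamma>) - b; the sign reverses the \<open>n\<close>
    differences.\<close>
  define q where "q = smult (c ^ n) (\<Prod>\<gamma>\<in>#proots u. smult ((-1) ^ n) [:poly h \<gamma>, -1:])"
  have "(\<Prod>\<alpha>\<in>#proots (h - [:b:]). poly u \<alpha>) = poly q b" for b
  proof -
    let ?A = "proots (h - [:b:])"
    have deg: "degree (h - [:b:]) = n" unfolding n_def using h
      by (metis add_uminus_conv_diff degree_add_eq_left degree_minus degree_pCons_0)
    then have nz: "h - [:b:] \<noteq> 0" using h n_def by auto
    have lc: "lead_coeff (h - [:b:]) = 1" using h n_def
      by (simp only: deg) (simp add: coeff_pCons split: nat.split)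
    have sz: "size ?A = n" using alg_closed_proots(1)[OF nz] deg by simp
    have hb: "h - [:b:] = (\<Prod>x\<in>#?A. [:- x, 1:])" using alg_closed_proots(2)[OF nz] lc by simp
    have pm: "poly (prod_mset M) x = (\<Prod>P\<in>#M. poly P x)" for M and x :: 'a
      by (induction M) auto
    have hg: "poly h \<gamma> - b = (\<Prod>\<alpha>\<in>#?A. \<gamma> - \<alpha>)" for \<gamma>
      using arg_cong[OF hb, of "\<lambda>P. poly P \<gamma>"] by (simp add: pm image_mset.compositionality o_def)
    have uu: "poly u \<alpha> = c * (\<Prod>\<gamma>\<in>#proots u. \<alpha> - \<gamma>)" for \<alpha>
      using arg_cong[OF alg_closed_proots(2)[OF u], of "\<lambda>P. poly P \<alpha>"]
      by (simp add: pm image_mset.compositionality o_def c_def)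
    have neg: "(\<Prod>\<alpha>\<in>#A. \<alpha> - \<gamma>) = (-1) ^ size A * (\<Prod>\<alpha>\<in>#A. \<gamma> - \<alpha>)" for A and \<gamma> :: 'a
      by (induction A) (auto simp: algebra_simps)
    have "(\<Prod>\<alpha>\<in>#?A. poly u \<alpha>) = c ^ n * (\<Prod>\<alpha>\<in>#?A. \<Prod>\<gamma>\<in>#proots u. \<alpha> - \<gamma>)"
      by (simp add: uu prod_mset.distrib prod_mset_constant sz)
    also have "(\<Prod>\<alpha>\<in>#?A. \<Prod>\<gamma>\<in>#proots u. \<alpha> - \<gamma>) = (\<Prod>\<gamma>\<in>#proots u. \<Prod>\<alpha>\<in>#?A. \<alpha> - \<gamma>)"
      by (rule prod_mset.swap)
    also have "\<dots> = (\<Prod>\<gamma>\<in>#proots u. (-1) ^ n * (poly h \<gamma> - b))"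
      by (simp add: neg sz hg)
    also have "c ^ n * \<dots> = poly q b"
      unfolding q_def by (simp add: pm image_mset.compositionality o_def algebra_simps)
    finally show ?thesis .
  qed
  then show ?thesis by blast
qed

lemma sum_distinct_degrees_neq_0:
  fixes f :: "'i \<Rightarrow> 'a::comm_ring_1 poly"
  assumes fin: "finite I" and ne: "I \<noteq> {}" and nz: "\<And>i. i \<in> I \<Longrightarrow> f i \<noteq> 0"
    and inj: "inj_on (\<lambda>i. degree (f i)) I"
  shows "sum f I \<noteq> 0"
proof -
  obtain i0 where i0: "i0 \<in> I" "\<And>i. i \<in> I \<Longrightarrow> degree (f i) \<le> degree (f i0)"
    using obtains_MAX[OF fin ne, of "\<lambda>i. degree (f i)"] fin by (metis Max_ge finite_imageI imageI)
  have "coeff (sum f I) (degree (f i0)) = (\<Sum>i\<in>I. if i = i0 then lead_coeff (f i0) else 0)"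
    unfolding coeff_sum
  proof (rule sum.cong)
    fix i assume i: "i \<in> I"
    show "coeff (f i) (degree (f i0)) = (if i = i0 then lead_coeff (f i0) else 0)"
      using i0 i inj by (auto simp: inj_on_def intro!: coeff_eq_0 le_neq_implies_less)
  qed simp
  also have "\<dots> = lead_coeff (f i0)" using i0 fin by simp
  finally show ?thesis using nz[OF i0(1)] by auto
qed

text \<open>Modulo \<open>degree h\<close> the i-th term has degree \<open>i * degree d\<close>, and
  coprimality makes these residues distinct for i below \<open>degree h\<close>, so no top terms
  cancel. This independence over the polynomials in \<open>h\<close> is the usable form of a
  generically one-to-one parametrization.\<close>

lemma powers_independent_over_subring:
  fixes h d :: "'a::idom poly"
  assumes cop: "coprime (degree d) (degree h)" and dh: "degree h > 0"
    and sm: "(\<Sum>i<degree h. pcompose (c i) h * d ^ i) = 0" and i: "i < degree h"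
    and d0: "d \<noteq> 0"
  shows "c i = 0"
proof (rule ccontr)
  assume ci: "c i \<noteq> 0"
  define I where "I = {i. i < degree h \<and> c i \<noteq> 0}"
  let ?f = "\<lambda>i. pcompose (c i) h * d ^ i"
  have nz: "pcompose (c i) h \<noteq> 0" if "i \<in> I" for i
    using that dh by (auto simp: I_def pcompose_eq_0_iff)
  have deg: "degree (?f i) = degree (c i) * degree h + i * degree d" if "i \<in> I" for i
    using nz[OF that] d0 by (simp add: degree_mult_eq degree_pcompose degree_power_eq)
  have "sum ?f I = (\<Sum>i<degree h. ?f i)"
    by (rule sum.mono_neutral_left) (auto simp: I_def)
  also have "\<dots> = 0" by (rule sm)
  finally have "sum ?f I = 0" .
  moreover have "sum ?f I \<noteq> 0"
  proof (rule sum_distinct_degrees_neq_0)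
    show "finite I" by (simp add: I_def)
    show "I \<noteq> {}" using ci i by (auto simp: I_def)
    show "?f i \<noteq> 0" if "i \<in> I" for i using nz[OF that] d0 by simp
    show "inj_on (\<lambda>i. degree (?f i)) I"
    proof
      fix i j assume ij: "i \<in> I" "j \<in> I" and eq: "degree (?f i) = degree (?f j)"
      define n where "n = int (degree h)"
      have "int (degree (c i)) * n + int i * int (degree d) = int (degree (c j)) * n + int j * int (degree d)"
        using eq unfolding deg[OF ij(1)] deg[OF ij(2)] n_def by (metis of_nat_add of_nat_mult)
      then have "(int i - int j) * int (degree d) = n * (int (degree (c j)) - int (degree (c i)))"
        by (simp add: algebra_simps)
      then have "n dvd (int i - int j) * int (degree d)" by simp
      then have "n dvd int i - int j"
        using cop by (simp add: n_def coprime_dvd_mult_left_iff coprime_commute)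
      moreover have "\<bar>int i - int j\<bar> < n" using ij by (auto simp: I_def n_def)
      ultimately show "i = j" using dvd_imp_le_int[of "int i - int j" n] by force
    qed
  qed
  ultimately show False by contradiction
qed

lemma lagrange_basis:
  fixes z :: "nat \<Rightarrow> 'a::field"
  assumes inj: "inj_on z {..<n}"
  shows "\<exists>L. (\<forall>l<n. degree (L l) < n) \<and> (\<forall>P. degree P < n \<longrightarrow> P = (\<Sum>l<n. smult (poly P (z l)) (L l)))"
proof -
  define N where "N = (\<lambda>l. \<Prod>k\<in>{..<n} - {l}. [:- z k, 1:])"
  define L where "L = (\<lambda>l. smult (inverse (poly (N l) (z l))) (N l))"
  have N: "poly (N l) (z m) = 0 \<longleftrightarrow> m \<noteq> l" if "l < n" "m < n" for l m
    using that inj by (auto simp: N_def poly_prod prod_zero_iff inj_on_def)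
  have L: "poly (L l) (z m) = (if l = m then 1 else 0)" if "l < n" "m < n" for l m
    using N[OF that] that by (auto simp: L_def)
  have dL: "degree (L l) < n" if "l < n" for l
  proof -
    have "degree (N l) = card ({..<n} - {l})"
      unfolding N_def by (subst degree_prod_eq_sum_degree) auto
    then show ?thesis using that degree_smult_le[of _ "N l"] unfolding L_def
      by (metis card_Diff_singleton card_lessThan diff_less le_less_trans lessThan_iff less_one gr_implies_not0 neq0_conv)
  qed
  have "P = (\<Sum>l<n. smult (poly P (z l)) (L l))" if "degree P < n" for P
  proof (rule poly_eqI_degree[of "z ` {..<n}"])
    have card: "card (z ` {..<n}) = n" using inj by (simp add: card_image)
    show "degree P < card (z ` {..<n})" using that card by simp
    have "degree (\<Sum>l<n. smult (poly P (z l)) (L l)) < n"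
      using that dL by (intro degree_sum_less) (auto intro: le_less_trans[OF degree_smult_le])
    then show "degree (\<Sum>l<n. smult (poly P (z l)) (L l)) < card (z ` {..<n})" using card by simp
    fix x assume "x \<in> z ` {..<n}"
    then obtain m where m: "m < n" "x = z m" by auto
    have "poly (\<Sum>l<n. smult (poly P (z l)) (L l)) x = (\<Sum>l<n. poly P (z l) * (if l = m then 1 else 0))"
      unfolding poly_sum m(2) by (rule sum.cong) (use L m in auto)
    also have "\<dots> = (\<Sum>l<n. if l = m then poly P (z l) else 0)"
      by (rule sum.cong) auto
    finally show "poly P x = poly (\<Sum>l<n. smult (poly P (z l)) (L l)) x" using m by simp
  qed
  then show ?thesis using dL by blast
qed

text \<open>\<open>E\<close> stands for a polynomial in two variables; Lagrange interpolation in the second one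
  recovers its coefficients as polynomials in the first.\<close>

lemma vanishing_on_parametrization:
  fixes h d :: "'a::alg_closed_field poly" and E :: "'a \<Rightarrow> 'a poly"
  assumes cop: "coprime (degree d) (degree h)" and dh: "degree h > 0" and d0: "d \<noteq> 0"
    and dE: "\<And>b. degree (E b) < degree h"
    and poly: "\<And>z. \<exists>q. \<forall>b. poly (E b) z = poly q b"
    and van: "\<And>x. poly (E (poly h x)) (poly d x) = 0"
  shows "E b = 0"
proof -
  let ?n = "degree h"
  obtain z :: "nat \<Rightarrow> 'a" where z: "inj z"
    using infinite_UNIV_alg_closed infinite_countable_subset by blast
  obtain L where L: "\<forall>P. degree P < ?n \<longrightarrow> P = (\<Sum>l<?n. smult (poly P (z l)) (L l))"
    using lagrange_basis[OF inj_on_subset[OF z subset_UNIV], of ?n] by blast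
  define q where "q = (\<lambda>l. SOME q. \<forall>b. poly (E b) (z l) = poly q b)"
  have q: "poly (E b) (z l) = poly (q l) b" for l b
    using someI_ex[OF poly[of "z l"]] unfolding q_def by blast
  have E: "E b = (\<Sum>l<?n. smult (poly (q l) b) (L l))" for b
    using L[rule_format, OF dE[of b]] q by simp
  define c where "c = (\<lambda>i. \<Sum>l<?n. smult (coeff (L l) i) (q l))"
  have Ec: "coeff (E b) i = poly (c i) b" for b i
    by (subst E) (simp add: c_def coeff_sum poly_sum mult.commute)
  have Es: "poly (E b) y = (\<Sum>i<?n. poly (c i) b * y ^ i)" for b y
  proof -
    have "poly (E b) y = (\<Sum>i\<le>degree (E b). coeff (E b) i * y ^ i)" by (rule poly_altdef)
    also have "\<dots> = (\<Sum>i<?n. coeff (E b) i * y ^ i)"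
      by (rule sum.mono_neutral_left) (use dE[of b] in \<open>auto simp: coeff_eq_0\<close>)
    finally show ?thesis by (simp add: Ec)
  qed
  have "(\<Sum>i<?n. pcompose (c i) h * d ^ i) = 0"
    by (rule alg_closed_poly_eqI) (use van in \<open>simp add: Es poly_sum poly_pcompose\<close>)
  then have "c i = 0" if "i < ?n" for i
    using powers_independent_over_subring[OF cop dh _ that d0] by blast
  then have "coeff (E b) i = 0" for i
    using Ec[of b i] dE[of b] coeff_eq_0[of "E b" i] by (cases "i < ?n") simp_all
  then show ?thesis by (simp add: poly_eq_iff)
qed

lemma degree_prod_linear_mset: "degree (\<Prod>x\<in>#A. [:- f x, 1::'a::idom:]) = size A"
  and lead_coeff_prod_linear_mset: "coeff (\<Prod>x\<in>#A. [:- f x, 1::'a:]) (size A) = 1"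
proof -
  have "degree (\<Prod>x\<in>#A. [:- f x, 1::'a:]) = size A \<and> lead_coeff (\<Prod>x\<in>#A. [:- f x, 1::'a:]) = 1"
  proof (induction A)
    case (add x A)
    then have "(\<Prod>x\<in>#A. [:- f x, 1::'a:]) \<noteq> 0" by (auto simp: prod_mset_zero_iff)
    then have "degree ([:- f x, 1::'a:] * (\<Prod>x\<in>#A. [:- f x, 1::'a:])) = Suc (size A)"
      using add by (subst degree_mult_eq) auto
    moreover have "lead_coeff ([:- f x, 1::'a:] * (\<Prod>x\<in>#A. [:- f x, 1::'a:])) = 1"
      using add by (subst lead_coeff_mult) auto
    ultimately show ?case by (simp del: mult_pCons_left)
  qed simp
  then show "degree (\<Prod>x\<in>#A. [:- f x, 1::'a:]) = size A" "coeff (\<Prod>x\<in>#A. [:- f x, 1::'a:]) (size A) = 1"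
    by auto
qed

text \<open>The free variable is y = z - b, because \<open>hs - h\<close> has degree coprime to
  \<open>degree h\<close> and \<open>hs\<close> itself does not. Both sides are monic in y of degree
  \<open>degree h\<close>, so their difference has smaller degree; it vanishes along (h(x), (hs -
  h)(x)) and is therefore zero.\<close>

theorem fibre_product:
  fixes g h gs hs :: "'a::alg_closed_field poly"
  assumes h: "lead_coeff h = 1" "degree h > 0"
    and gs: "lead_coeff gs = 1" "degree gs = degree h"
    and eq: "pcompose g h = pcompose gs hs"
    and cop: "coprime (degree (hs - h)) (degree h)" and d: "degree (hs - h) > 0"
  shows "(\<Prod>\<alpha>\<in>#proots (h - [:b:]). [:- poly (hs - h) \<alpha>, 1:]) = pcompose gs [:b, 1:] - [:poly g b:]"
proof -
  let ?Q = "\<lambda>b. (\<Prod>\<alpha>\<in>#proots (h - [:b:]). [:- poly (hs - h) \<alpha>, 1:])"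
  define E where "E = (\<lambda>b. ?Q b - (pcompose gs [:b, 1:] - [:poly g b:]))"
  have sz: "size (proots (h - [:b:])) = degree h" and nzb: "h - [:b:] \<noteq> 0" for b
  proof -
    have deg: "degree (h - [:b:]) = degree h" using h
      by (metis add_uminus_conv_diff degree_add_eq_left degree_minus degree_pCons_0)
    then show "h - [:b:] \<noteq> 0" using h by auto
    then show "size (proots (h - [:b:])) = degree h" using alg_closed_proots(1) deg by metis
  qed
  have pm: "poly (prod_mset M) x = (\<Prod>P\<in>#M. poly P x)" for M and x :: 'a
    by (induction M) auto
  have "E b = 0"
  proof (rule vanishing_on_parametrization[of "hs - h" h E])
    show "coprime (degree (hs - h)) (degree h)" "degree h > 0" "hs - h \<noteq> 0"
      using cop h d by auto
    show "degree (E b) < degree h" for b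
    proof -
      have dg: "degree (pcompose gs [:b, 1:]) = degree h" by (simp add: degree_pcompose gs)
      have "lead_coeff (pcompose gs [:b, 1:]) = 1" using gs by (subst lead_coeff_comp) simp_all
      then have c1: "coeff (pcompose gs [:b, 1:]) (degree h) = 1" using dg by simp
      have c2: "coeff (?Q b) (degree h) = 1"
        using lead_coeff_prod_linear_mset[of "\<lambda>\<alpha>. poly (hs - h) \<alpha>" "proots (h - [:b:])"] sz by simp
      have "coeff (E b) (degree h) = 0"
        unfolding E_def using h(2) c1 c2 by (simp add: coeff_pCons split: nat.split)
      moreover have "degree (E b) \<le> degree h"
        unfolding E_def using dg degree_prod_linear_mset[of "\<lambda>\<alpha>. poly (hs - h) \<alpha>" "proots (h - [:b:])"] sz
        by (intro degree_diff_le) auto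
      ultimately show ?thesis using h(2)
        by (metis degree_0 leading_coeff_0_iff le_neq_implies_less)
    qed
    show "\<exists>q. \<forall>b. poly (E b) z = poly q b" for z
    proof -
      \<comment> \<open>At a fixed value z of the variable the product is the norm of z - (hs - h),
        hence polynomial in \<open>b\<close>.\<close>
      have "degree ([:z:] - (hs - h)) = degree (hs - h)" using d
        by (metis degree_add_eq_right degree_minus degree_pCons_0 add_uminus_conv_diff)
      then have "[:z:] - (hs - h) \<noteq> 0" using d by auto
      from prod_over_fibre_is_poly[OF h this] obtain q where
        q: "\<And>b. (\<Prod>\<alpha>\<in>#proots (h - [:b:]). poly ([:z:] - (hs - h)) \<alpha>) = poly q b" by blast
      have "poly (E b) z = poly (q - (pcompose gs [:z, 1:] - g)) b" for b
        unfolding E_def using q[of b]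
        by (simp add: pm image_mset.compositionality o_def poly_pcompose algebra_simps)
      then show ?thesis by blast
    qed
    show "poly (E (poly h x)) (poly (hs - h) x) = 0" for x
    proof -
      have "x \<in># proots (h - [:poly h x:])" using nzb[of "poly h x"] by simp
      then have "[:- poly (hs - h) x, 1:] dvd ?Q (poly h x)"
        by (intro dvd_prod_mset) (auto simp del: poly_diff)
      then have "poly (?Q (poly h x)) (poly (hs - h) x) = 0"
        by (simp only: poly_eq_0_iff_dvd)
      moreover have "poly gs (poly hs x) = poly g (poly h x)"
        using eq by (metis poly_pcompose)
      ultimately show ?thesis by (simp add: E_def poly_pcompose)
    qed
  qed
  then show ?thesis by (simp add: E_def)
qed

section \<open>Multiplicities under composition\<close>

lemma order_power: "order a (P ^ n) = n * order a P" if "P \<noteq> 0" for P :: "'a::idom poly"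
  using that by (induction n) (auto simp: order_mult)

lemma order_linear_self [simp]: "order a [:- a, 1::'a::idom:] = 1"
  using order_power_n_n[of a 1] by simp

text \<open>Split off from \<open>P\<close> the full power of x - b with b = q(a); the cofactor does
  not vanish at b, so after composition it does not vanish at \<open>a\<close>.\<close>

lemma order_pcompose:
  fixes P q :: "'a::idom poly"
  assumes P: "P \<noteq> 0" and q: "degree q > 0"
  shows "order a (pcompose P q) = order (poly q a) P * order a (q - [:poly q a:])"
proof -
  define b where "b = poly q a"
  obtain Q where Q: "P = [:- b, 1:] ^ order b P * Q" "\<not> [:- b, 1:] dvd Q"
    using order_decomp[OF P, of b] by blast
  have "poly Q b \<noteq> 0" using Q(2) by (simp add: poly_eq_0_iff_dvd)
  then have Q0: "poly (pcompose Q q) a \<noteq> 0" by (simp add: poly_pcompose b_def)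
  have qb: "q - [:b:] \<noteq> 0" using q by auto
  have cp: "pcompose ([:- b, 1:] ^ n) q = (q - [:b:]) ^ n" for n
    by (induction n) (simp_all add: pcompose_mult pcompose_pCons pcompose_1 del: mult_pCons_left)
  have "pcompose P q = (q - [:b:]) ^ order b P * pcompose Q q"
    by (subst Q(1)) (simp add: pcompose_mult cp)
  moreover have "pcompose Q q \<noteq> 0" using Q0 by auto
  ultimately show ?thesis
    using qb Q0 by (simp add: order_mult order_power order_0I b_def)
qed

lemma minus_const_neq_0: "degree P > 0 \<Longrightarrow> P - [:c:] \<noteq> (0::'a::ring_1 poly)"
  by (metis degree_pCons_0 eq_iff_diff_eq_0 less_irrefl)

text \<open>The ramification index of \<open>P\<close> at \<open>a\<close> as a map of the affine
  line; for nonconstant \<open>P\<close> it is at least 1.\<close>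

definition root_mult :: "'a::idom poly \<Rightarrow> 'a \<Rightarrow> nat" where
  "root_mult P a = order a (P - [:poly P a:])"

lemma root_mult_pcompose:
  fixes P q :: "'a::idom poly"
  assumes P: "degree P > 0" and q: "degree q > 0"
  shows "root_mult (pcompose P q) a = root_mult P (poly q a) * root_mult q a"
proof -
  have "pcompose P q - [:poly (pcompose P q) a:] = pcompose (P - [:poly P (poly q a):]) q"
    by (simp add: pcompose_diff poly_pcompose)
  moreover have "P - [:poly P (poly q a):] \<noteq> 0" using minus_const_neq_0[OF P] .
  ultimately show ?thesis using q by (simp add: root_mult_def order_pcompose)
qed

text \<open>Compare the orders at y = z - b of the two sides of \<open>fibre_product\<close>: the
  product counts the roots of \<open>h - b\<close> with \<open>hs\<close>-value \<open>z\<close>,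
  the other side is \<open>gs\<close> centred at \<open>z\<close>.\<close>

corollary sum_root_mult_over:
  fixes g h gs hs :: "'a::alg_closed_field poly"
  assumes h: "lead_coeff h = 1" "degree h > 0"
    and gs: "lead_coeff gs = 1" "degree gs = degree h"
    and eq: "pcompose g h = pcompose gs hs"
    and cop: "coprime (degree (hs - h)) (degree h)" and d: "degree (hs - h) > 0"
    and bz: "poly g b = poly gs z"
  shows "(\<Sum>\<alpha> | poly h \<alpha> = b \<and> poly hs \<alpha> = z. root_mult h \<alpha>) = root_mult gs z"
proof -
  let ?A = "proots (h - [:b:])" and ?d = "poly (hs - h)"
  have nz: "h - [:b:] \<noteq> 0" using minus_const_neq_0[OF h(2)] .
  have "root_mult gs z = order z (gs - [:poly g b:])" by (simp add: root_mult_def bz)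
  also have "\<dots> = order (z - b) (pcompose (gs - [:poly g b:]) [:b, 1:])"
  proof -
    have "[:b, 1:] - [:z:] = [:- (z - b), 1:]" by simp
    then have "order (z - b) ([:b, 1:] - [:z:]) = 1" by (simp only: order_linear_self)
    moreover have "gs - [:poly g b:] \<noteq> 0" using gs h minus_const_neq_0[of gs] by simp
    ultimately show ?thesis by (simp add: order_pcompose)
  qed
  also have "pcompose (gs - [:poly g b:]) [:b, 1:] = (\<Prod>\<alpha>\<in>#?A. [:- ?d \<alpha>, 1:])"
    using fibre_product[OF h gs eq cop d, of b] by (simp add: pcompose_diff)
  also have "order (z - b) \<dots> = count (image_mset ?d ?A) (z - b)"
  proof -
    have "(\<Prod>\<alpha>\<in>#?A. [:- ?d \<alpha>, 1:]) \<noteq> 0" by (rule prod_linear_mset_neq_0)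
    then show ?thesis by (metis proots_prod_linear_mset count_proots)
  qed
  also have "\<dots> = (\<Sum>\<alpha>\<in>?d -` {z - b} \<inter> set_mset ?A. count ?A \<alpha>)"
    by (rule count_image_mset)
  also have "\<dots> = (\<Sum>\<alpha> | poly h \<alpha> = b \<and> poly hs \<alpha> = z. root_mult h \<alpha>)"
    using nz by (intro sum.cong) (auto simp: root_mult_def)
  finally show ?thesis by simp
qed

section \<open>Root multiplicities\<close>

lemma root_mult_pos: "degree P > 0 \<Longrightarrow> root_mult P a > 0"
  unfolding root_mult_def using minus_const_neq_0[of P] by (subst order_gt_0_iff) auto

context
  fixes p :: nat and P :: "'a::field poly"
  assumes p: "prime p" "CHAR('a) = p" and P: "degree P = p" "pderiv P \<noteq> 0"
begin

lemma degree_minus_const: "degree (P - [:c:]) = p"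
  using P p prime_gt_0_nat[of p]
  by (metis add_uminus_conv_diff degree_add_eq_left degree_minus degree_pCons_0)

text \<open>Multiplicity \<open>p\<close> would leave P - P(a) a constant multiple of (x - a)^p,
  whose derivative is zero.\<close>

lemma root_mult_less: "root_mult P a < p"
proof -
  let ?P = "P - [:poly P a:]"
  have nz: "?P \<noteq> 0" using minus_const_neq_0[of P] P p prime_gt_0_nat[of p] by auto
  have "root_mult P a \<le> p"
    unfolding root_mult_def using order_degree[OF nz, of a] degree_minus_const by simp
  moreover have "root_mult P a \<noteq> p"
  proof
    assume eq: "root_mult P a = p"
    obtain Q where Q: "?P = [:- a, 1:] ^ p * Q"
      using order_1[of a ?P] eq unfolding root_mult_def dvd_def by auto
    obtain n where n: "p = Suc n" using p prime_gt_0_nat[of p] by (cases p) auto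
    have "Q \<noteq> 0" using Q nz by auto
    then have "degree ?P = p + degree Q" unfolding Q
      by (subst degree_mult_eq) (auto simp: degree_linear_power)
    then have "degree Q = 0" using degree_minus_const by simp
    then have "pderiv Q = 0" by (auto elim: degree_eq_zeroE)
    moreover have "of_nat p = (0::'a)" using p of_nat_CHAR[where 'a='a] by simp
    ultimately have "pderiv ?P = 0"
      unfolding Q unfolding n lemma_order_pderiv1 by (simp flip: n del: of_nat_Suc)
    then show False using P by (simp add: pderiv_diff)
  qed
  ultimately show ?thesis by simp
qed

text \<open>All ramification is tame: the multiplicity lies strictly between 0 and \<open>p\<close>
  or equals 1, so it is nonzero in the field and drops by exactly one.\<close>

lemma order_pderiv_root_mult: "order a (pderiv P) = root_mult P a - 1"
proof -
  let ?P = "P - [:poly P a:]"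
  have nz: "?P \<noteq> 0" using minus_const_neq_0[of P] P p prime_gt_0_nat[of p] by auto
  obtain n where n: "root_mult P a = Suc n"
    using root_mult_pos[of P a] P p prime_gt_0_nat[of p] by (cases "root_mult P a") auto
  then have k0: "of_nat (Suc n) \<noteq> (0::'a)"
    using of_nat_neq_0_less_CHAR[where 'a='a, of "Suc n"] root_mult_less[of a] p by simp
  obtain Q where Q: "?P = [:- a, 1:] ^ Suc n * Q" "\<not> [:- a, 1:] dvd Q"
    using order_decomp[OF nz, of a] n unfolding root_mult_def by auto
  define R where "R = [:- a, 1:] * pderiv Q + smult (of_nat (Suc n)) Q"
  have "poly R a \<noteq> 0" using k0 Q(2) by (simp add: R_def poly_eq_0_iff_dvd del: of_nat_Suc)
  moreover have "pderiv P = [:- a, 1:] ^ n * R"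
  proof -
    have "pderiv P = pderiv ?P" by (simp add: pderiv_diff)
    also have "\<dots> = [:- a, 1:] ^ n * R"
      unfolding Q(1) lemma_order_pderiv1 R_def
      by (simp only: power_Suc distrib_left mult_smult_right mult_smult_left mult_ac)
    finally show ?thesis .
  qed
  moreover from this have "R \<noteq> 0" using P by auto
  ultimately show ?thesis
    by (simp add: order_mult order_power_n_n order_0I n)
qed

lemma root_mult_gt_1_iff: "root_mult P a > 1 \<longleftrightarrow> poly (pderiv P) a = 0"
  using order_root[of "pderiv P" a] order_pderiv_root_mult[of a] P by auto

lemma finite_critical_points: "finite {a. root_mult P a > 1}"
  unfolding root_mult_gt_1_iff by (rule poly_roots_finite[OF P(2)])

lemma finite_poly_fibre: "finite {a. poly P a = c}"
proof -
  have "{a. poly P a = c} = {a. poly (P - [:c:]) a = 0}" by auto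
  moreover have "P - [:c:] \<noteq> 0" using minus_const_neq_0[of P c] P p prime_gt_0_nat[of p] by simp
  ultimately show ?thesis using poly_roots_finite by metis
qed

end

lemma sum_order_alg_closed:
  fixes P :: "'a::alg_closed_field poly"
  assumes "P \<noteq> 0"
  shows "(\<Sum>a | poly P a = 0. order a P) = degree P"
proof -
  have "(\<Sum>a | poly P a = 0. order a P) = (\<Sum>a\<in>set_mset (proots P). count (proots P) a)"
    using assms by simp
  also have "\<dots> = size (proots P)" by (rule size_multiset_overloaded_eq[symmetric])
  finally show ?thesis using alg_closed_proots(1)[OF assms] by simp
qed

context
  fixes p :: nat and P :: "'a::alg_closed_field poly"
  assumes p: "prime p" "CHAR('a) = p" and P: "degree P = p" "pderiv P \<noteq> 0"
begin

lemma sum_root_mult_fibre: "(\<Sum>a | poly P a = c. root_mult P a) = p"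
proof -
  have nz: "P - [:c:] \<noteq> 0" using minus_const_neq_0[of P] P p prime_gt_0_nat[of p] by auto
  have "(\<Sum>a | poly P a = c. root_mult P a) = (\<Sum>a | poly (P - [:c:]) a = 0. order a (P - [:c:]))"
    by (rule sum.cong) (auto simp: root_mult_def)
  then show ?thesis using sum_order_alg_closed[OF nz] degree_minus_const[OF p P] by simp
qed

text \<open>The tame Riemann-Hurwitz count over the finite points; it translates the equal degrees
  of the derivatives into equal total ramification.\<close>

lemma sum_ramification: "(\<Sum>a | root_mult P a > 1. root_mult P a - 1) = degree (pderiv P)"
  unfolding root_mult_gt_1_iff[OF p P] order_pderiv_root_mult[OF p P, symmetric]
  by (rule sum_order_alg_closed[OF P(2)])

end

text \<open>Since \<open>d\<close> does not divide \<open>p\<close>, it fails to divide some part, and each such part contributes at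
  least \<open>d/2\<close>; two of them already exceed the bound.\<close>

lemma defect_bound:
  fixes e x :: "'b \<Rightarrow> nat"
  assumes fin: "finite B" and p: "prime p" and sm: "sum e B = p" and d: "1 < d" "d < p"
    and x: "\<And>b. b \<in> B \<Longrightarrow> d \<le> x b + gcd (e b) d"
  shows "d - 1 \<le> sum x B"
    and "sum x B = d - 1 \<Longrightarrow> \<exists>b0\<in>B. \<not> d dvd e b0 \<and> coprime (e b0) d \<and> x b0 = d - 1 \<and>
          (\<forall>b\<in>B - {b0}. d dvd e b \<and> x b = 0)"
proof -
  have small: "q = 1" if "q dvd p" "q \<le> d" for q
    using p that d by (metis not_less prime_nat_iff)
  have "\<exists>b\<in>B. \<not> d dvd e b"
  proof (rule ccontr)
    assume "\<not> ?thesis"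
    then have "d dvd p" using sm by (metis dvd_sum)
    then show False using small[of d] d by simp
  qed
  then obtain b0 where b0: "b0 \<in> B" "\<not> d dvd e b0" by blast
  have half: "d \<le> 2 * x b" if "b \<in> B" "\<not> d dvd e b" for b
  proof -
    have "gcd (e b) d \<noteq> d" using that by (metis gcd_dvd1)
    moreover obtain t where t: "d = gcd (e b) d * t" by (metis gcd_dvd2 dvd_def)
    ultimately have "t \<noteq> 1" "t \<noteq> 0" using d by (metis mult.right_neutral, metis mult_0_right not_less0)
    then have "gcd (e b) d * 2 \<le> gcd (e b) d * t" by (intro mult_le_mono) auto
    then show ?thesis using x[OF that(1)] t by linarith
  qed
  have split: "sum x B = x b0 + sum x (B - {b0})" using fin b0 by (simp add: sum.remove)
  have main: "d - 1 \<le> sum x B \<and> (sum x B = d - 1 \<longrightarrow> coprime (e b0) d \<and> x b0 = d - 1 \<and>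
          (\<forall>b\<in>B - {b0}. d dvd e b \<and> x b = 0))"
    proof (cases "\<exists>b1\<in>B - {b0}. \<not> d dvd e b1")
      case True
      then obtain b1 where b1: "b1 \<in> B - {b0}" "\<not> d dvd e b1" by blast
      have "x b1 \<le> sum x (B - {b0})" using fin b1 by (intro member_le_sum) auto
      then have "d \<le> sum x B" using half[OF b0] half[of b1] b1 split by auto
      then show ?thesis using d by auto
    next
      case False
      then have dv: "d dvd e b" if "b \<in> B - {b0}" for b using that by blast
      \<comment> \<open>With a single part not divisible by \<open>d\<close>, the gcd divides every
        part and hence the prime \<open>p\<close>; being at most d < p, it is 1.\<close>
      have "gcd (e b0) d dvd sum e (B - {b0})"
        by (rule dvd_sum) (use dv in \<open>meson dvd_trans gcd_dvd2\<close>)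
      then have "gcd (e b0) d dvd p"
        using sm sum.remove[OF fin b0(1), of e] by (metis dvd_add gcd_dvd1)
      then have g1: "gcd (e b0) d = 1" using small[of "gcd (e b0) d"] d by (simp add: gcd_le2_nat)
      then have le: "d - 1 \<le> x b0" using x[OF b0(1)] by simp
      show ?thesis
      proof (intro conjI impI ballI)
        show "d - 1 \<le> sum x B" using le split by simp
        assume eq: "sum x B = d - 1"
        show "coprime (e b0) d" using g1 by (simp add: coprime_iff_gcd_eq_1)
        show "x b0 = d - 1" using eq le split by simp
        fix b assume b: "b \<in> B - {b0}"
        show "d dvd e b" using dv[OF b] .
        have "x b \<le> sum x (B - {b0})" using fin b by (intro member_le_sum) auto
        then show "x b = 0" using eq le split by simp
      qed
    qed
  show "d - 1 \<le> sum x B" using main by blast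
  show "\<exists>b0\<in>B. \<not> d dvd e b0 \<and> coprime (e b0) d \<and> x b0 = d - 1 \<and>
          (\<forall>b\<in>B - {b0}. d dvd e b \<and> x b = 0)" if "sum x B = d - 1"
    using main that b0 by blast
qed

text \<open>\<open>M\<close> is the largest multiplicity on both sides. Being divisible by
  \<open>M\<close> and at most \<open>M\<close> means being equal to \<open>M\<close>, so
  \<open>H2\<close> at \<open>b1\<close> fixes all but one value of \<open>e'\<close>, and
  \<open>H1\<close> at one of the values so fixed does the same for \<open>e\<close>. The two
  exceptional values are coprime to \<open>M\<close>, hence below it.\<close>

lemma two_profiles_aux:
  fixes e :: "'b \<Rightarrow> nat" and e' :: "'c \<Rightarrow> nat"
  assumes fin: "finite E" "finite E'" 
    and sm: "sum e E = p" "sum e' E' = p"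
    and pos: "\<And>b. b \<in> E \<Longrightarrow> 0 < e b" "\<And>z. z \<in> E' \<Longrightarrow> 0 < e' z"
    and lt: "\<And>b. b \<in> E \<Longrightarrow> e b < p" "\<And>z. z \<in> E' \<Longrightarrow> e' z < p"
    and H1: "\<And>z. z \<in> E' \<Longrightarrow> 1 < e' z \<Longrightarrow> \<exists>b0\<in>E. coprime (e b0) (e' z) \<and> (\<forall>b\<in>E - {b0}. e' z dvd e b)"
    and H2: "\<And>b. b \<in> E \<Longrightarrow> 1 < e b \<Longrightarrow> \<exists>z0\<in>E'. coprime (e' z0) (e b) \<and> (\<forall>z\<in>E' - {z0}. e b dvd e' z)"
    and b1: "b1 \<in> E" "1 < e b1" and mx: "\<And>b. b \<in> E \<Longrightarrow> e b \<le> e b1" "\<And>z. z \<in> E' \<Longrightarrow> e' z \<le> e b1"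
  shows "\<exists>u M. \<exists>b0\<in>E. \<exists>z0\<in>E'. 0 < u \<and> u < M \<and> coprime u M \<and> e b0 = u \<and> e' z0 = u \<and>
    (\<forall>b\<in>E - {b0}. e b = M) \<and> (\<forall>z\<in>E' - {z0}. e' z = M) \<and> card E = card E' \<and> (u = 1 \<or> card E = 2)"
proof -
  define M where "M = e b1"
  obtain z0 where z0: "z0 \<in> E'" "coprime (e' z0) M" "\<And>z. z \<in> E' - {z0} \<Longrightarrow> M dvd e' z"
    using H2[OF b1] unfolding M_def by blast
  have eM': "e' z = M" if "z \<in> E' - {z0}" for z
    using that z0(3)[OF that] mx(2)[of z] pos(2)[of z] by (auto simp: M_def intro: antisym dvd_imp_le)
  have "E' - {z0} \<noteq> {}"
    using sm(2) lt(2)[OF z0(1)] sum.remove[OF fin(2) z0(1), of e'] by (metis add.right_neutral less_irrefl sum.empty)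
  then obtain z1 where z1: "z1 \<in> E' - {z0}" by blast
  obtain b0 where b0: "b0 \<in> E" "coprime (e b0) M" "\<And>b. b \<in> E - {b0} \<Longrightarrow> M dvd e b"
    using H1[of z1] z1 eM'[OF z1] b1 by (auto simp: M_def)
  have eM: "e b = M" if "b \<in> E - {b0}" for b
    using that b0(3)[OF that] mx(1)[of b] pos(1)[of b] by (auto simp: M_def intro: antisym dvd_imp_le)
  have M1: "M > 1" using b1 by (simp add: M_def)
  have less: "e b0 < M" "e' z0 < M"
    using mx(1)[OF b0(1)] mx(2)[OF z0(1)] b0(2) z0(2) M1 by (auto simp: M_def le_less)
  have s1: "p = e b0 + card (E - {b0}) * M"
    using sm(1) sum.remove[OF fin(1) b0(1), of e] eM by simp
  have s2: "p = e' z0 + card (E' - {z0}) * M"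
    using sm(2) sum.remove[OF fin(2) z0(1), of e'] eM' by simp
  \<comment> \<open>Both exceptional values are the remainder of \<open>p\<close> modulo
    \<open>M\<close>, so they coincide, and so do the numbers of parts.\<close>
  have "p mod M = e b0" using less by (subst s1) simp
  moreover have "p mod M = e' z0" using less by (subst s2) simp
  ultimately have eq: "e' z0 = e b0" by simp
  then have "card (E - {b0}) * M = card (E' - {z0}) * M" using s1 s2 by (metis add_left_cancel)
  then have cards: "card (E - {b0}) = card (E' - {z0})" using M1 by simp
  have c: "card E = Suc (card (E - {b0}))" "card E' = Suc (card (E' - {z0}))"
    using fin b0 z0 by (simp_all only: card_Suc_Diff1)
  \<comment> \<open>For u > 1, \<open>H1\<close> at \<open>z0\<close> makes u divide all values of
    \<open>e\<close> but one. The value \<open>M\<close> is coprime to u, so it can occur only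
    once.\<close>
  have "card E = 2" if u1: "e b0 \<noteq> 1"
  proof -
    obtain bs where bs: "bs \<in> E" "\<And>b. b \<in> E - {bs} \<Longrightarrow> e b0 dvd e b"
      using H1[OF z0(1)] eq u1 pos(1)[OF b0(1)] by auto
    have "E - {b0} \<subseteq> {bs}"
    proof
      fix b assume b: "b \<in> E - {b0}"
      show "b \<in> {bs}"
      proof (rule ccontr)
        assume "b \<notin> {bs}"
        then have "e b0 dvd M" using bs(2)[of b] b eM by auto
        then show False using b0(2) u1 by (metis coprime_common_divisor_nat dvd_refl)
      qed
    qed
    moreover have "E - {b0} \<noteq> {}"
      using sm(1) lt(1)[OF b0(1)] sum.remove[OF fin(1) b0(1), of e] by (metis add.right_neutral less_irrefl sum.empty)
    ultimately have "E - {b0} = {bs}" by blast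
    then show ?thesis using c by simp
  qed
  then have "0 < e b0 \<and> e b0 < M \<and> coprime (e b0) M \<and> e b0 = e b0 \<and> e' z0 = e b0 \<and>
    (\<forall>b\<in>E - {b0}. e b = M) \<and> (\<forall>z\<in>E' - {z0}. e' z = M) \<and> card E = card E' \<and> (e b0 = 1 \<or> card E = 2)"
    using b0(2) eM eM' less(1) pos(1)[OF b0(1)] eq cards c by auto
  then show ?thesis using b0(1) z0(1) by (intro exI bexI) assumption+
qed

text \<open>The overall maximum may sit on either side; the two cases are mirror images of each
  other.\<close>

lemma two_profiles:
  fixes e :: "'b \<Rightarrow> nat" and e' :: "'c \<Rightarrow> nat"
  assumes fin: "finite E" "finite E'" 
    and sm: "sum e E = p" "sum e' E' = p"
    and pos: "\<And>b. b \<in> E \<Longrightarrow> 0 < e b" "\<And>z. z \<in> E' \<Longrightarrow> 0 < e' z"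
    and lt: "\<And>b. b \<in> E \<Longrightarrow> e b < p" "\<And>z. z \<in> E' \<Longrightarrow> e' z < p"
    and H1: "\<And>z. z \<in> E' \<Longrightarrow> 1 < e' z \<Longrightarrow> \<exists>b0\<in>E. coprime (e b0) (e' z) \<and> (\<forall>b\<in>E - {b0}. e' z dvd e b)"
    and H2: "\<And>b. b \<in> E \<Longrightarrow> 1 < e b \<Longrightarrow> \<exists>z0\<in>E'. coprime (e' z0) (e b) \<and> (\<forall>z\<in>E' - {z0}. e b dvd e' z)"
    and b: "b \<in> E" "1 < e b"
  shows "\<exists>u M. \<exists>b0\<in>E. \<exists>z0\<in>E'. 0 < u \<and> u < M \<and> coprime u M \<and> e b0 = u \<and> e' z0 = u \<and>
    (\<forall>b\<in>E - {b0}. e b = M) \<and> (\<forall>z\<in>E' - {z0}. e' z = M) \<and> card E = card E' \<and> (u = 1 \<or> card E = 2)"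
proof -
  have "E \<noteq> {}" using b by auto
  then obtain b1 where b1: "b1 \<in> E" "\<And>b. b \<in> E \<Longrightarrow> e b \<le> e b1"
    using obtains_MAX[OF fin(1), of e] fin(1) by (metis Max_ge finite_imageI imageI)
  show ?thesis
  proof (cases "\<exists>z\<in>E'. e b1 < e' z")
    case False
    then have mx: "e' z \<le> e b1" if "z \<in> E'" for z using that not_less by blast
    have "1 < e b1" using b b1(2)[OF b(1)] by linarith
    show ?thesis
      by (rule two_profiles_aux[of E E' e p e' b1])
        (rule fin sm b1(1) \<open>1 < e b1\<close> | erule (1) H1 H2 | erule pos lt b1(2) mx)+
  next
    case True
    then have "E' \<noteq> {}" by auto
    then obtain z1 where z1: "z1 \<in> E'" "\<And>z. z \<in> E' \<Longrightarrow> e' z \<le> e' z1"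
      using obtains_MAX[OF fin(2), of e'] fin(2) by (metis Max_ge finite_imageI imageI)
    have "e b1 < e' z1" using True z1(2) by (meson less_le_trans)
    then have mx: "e b \<le> e' z1" if "b \<in> E" for b using b1(2)[OF that] by linarith
    have "1 < e' z1" using b mx[OF b(1)] by linarith
    have "\<exists>u M. \<exists>z0\<in>E'. \<exists>b0\<in>E. 0 < u \<and> u < M \<and> coprime u M \<and> e' z0 = u \<and> e b0 = u \<and>
        (\<forall>z\<in>E' - {z0}. e' z = M) \<and> (\<forall>b\<in>E - {b0}. e b = M) \<and> card E' = card E \<and> (u = 1 \<or> card E' = 2)"
      by (rule two_profiles_aux[of E' E e' p e z1])
        (rule fin sm z1(1) \<open>1 < e' z1\<close> | erule (1) H1 H2 | erule pos lt z1(2) mx)+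
    then obtain u M z0 b0 where "z0 \<in> E'" "b0 \<in> E"
      and A: "0 < u \<and> u < M \<and> coprime u M \<and> e' z0 = u \<and> e b0 = u \<and>
        (\<forall>z\<in>E' - {z0}. e' z = M) \<and> (\<forall>b\<in>E - {b0}. e b = M) \<and> card E' = card E \<and> (u = 1 \<or> card E' = 2)"
      by (elim exE bexE)
    from A have "0 < u \<and> u < M \<and> coprime u M \<and> e b0 = u \<and> e' z0 = u \<and>
        (\<forall>b\<in>E - {b0}. e b = M) \<and> (\<forall>z\<in>E' - {z0}. e' z = M) \<and> card E = card E' \<and> (u = 1 \<or> card E = 2)"
      by metis
    then show ?thesis using \<open>z0 \<in> E'\<close> \<open>b0 \<in> E\<close> by (intro exI bexI) assumption+
  qed
qed

section \<open>Ramification in a collision\<close>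

locale collision =
  fixes p :: nat and g h gs hs :: "'a::alg_closed_field poly"
  assumes prime: "prime p" and CHAR: "CHAR('a) = p"
    and g: "lead_coeff g = 1" "degree g = p" and h: "lead_coeff h = 1" "degree h = p" "coeff h 0 = 0"
    and gs: "lead_coeff gs = 1" "degree gs = p" and hs: "lead_coeff hs = 1" "degree hs = p" "coeff hs 0 = 0"
    and eq: "pcompose g h = pcompose gs hs" and ne: "h \<noteq> hs" and der: "pderiv (pcompose g h) \<noteq> 0"
begin

text \<open>Lets each statement about the ramification of \<open>gs\<close> and the points of
  \<open>h\<close> be reused for \<open>g\<close> and \<open>hs\<close>.\<close>

lemma swap: "collision p gs hs g h"
  using prime CHAR g h gs hs eq ne der by unfold_locales auto

lemma p_gt_1: "p > 1"
  using prime prime_gt_1_nat by simp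

lemma pderiv_nz: "pderiv g \<noteq> 0" "pderiv h \<noteq> 0" "pderiv gs \<noteq> 0" "pderiv hs \<noteq> 0"
  using der by (auto simp: pderiv_pcompose) (use der eq in \<open>auto simp: pderiv_pcompose\<close>)

lemmas degrees = collision_degrees[OF prime CHAR g h gs hs eq ne der]

abbreviation "f \<equiv> pcompose g h"

lemmas at_g = prime CHAR g(2) pderiv_nz(1)
lemmas at_h = prime CHAR h(2) pderiv_nz(2)
lemmas at_gs = prime CHAR gs(2) pderiv_nz(3)
lemmas at_hs = prime CHAR hs(2) pderiv_nz(4)

lemma eq_at: "poly g (poly h a) = poly gs (poly hs a)"
  using eq by (metis poly_pcompose)

lemma root_mult_f: "root_mult f a = root_mult g (poly h a) * root_mult h a"
  using p_gt_1 g h by (intro root_mult_pcompose) auto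

lemma root_mult_f': "root_mult f a = root_mult gs (poly hs a) * root_mult hs a"
  unfolding eq using p_gt_1 gs hs by (intro root_mult_pcompose) auto

lemma pos: "0 < root_mult g a" "0 < root_mult h a" "0 < root_mult gs a" "0 < root_mult hs a"
  using p_gt_1 g h gs hs by (auto intro!: root_mult_pos)

definition common :: "'a \<Rightarrow> 'a \<Rightarrow> 'a set" where
  "common b z = {a. poly h a = b \<and> poly hs a = z}"

lemma finite_over: "finite (common b z)"
  by (rule finite_subset[OF _ finite_poly_fibre[OF at_h, of b]]) (auto simp: common_def)

lemma sum_over: "poly g b = poly gs z \<Longrightarrow> (\<Sum>a\<in>common b z. root_mult h a) = root_mult gs z"
proof -
  assume bz: "poly g b = poly gs z"
  have less: "degree (hs - h) < p"
    using degrees(4) degree_pderiv_monic_less[OF prime CHAR g] by simp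
  have "coprime (degree (hs - h)) p"
  proof (rule coprime_commute[THEN iffD1], rule prime_imp_coprime[OF prime])
    show "\<not> p dvd degree (hs - h)" using less degrees(4) by (auto dest: dvd_imp_le)
  qed
  then show ?thesis unfolding common_def
    using sum_root_mult_over[of h gs g hs b z] h gs eq degrees(4) bz p_gt_1 by auto
qed

text \<open>Computing the multiplicity of \<open>f\<close> along both decompositions gives e *
  mult(h) = d * mult(hs), with e and d the multiplicities of \<open>g\<close> at \<open>b\<close>
  and of \<open>gs\<close> at \<open>z\<close>. So d / gcd(e, d) divides the multiplicity of
  \<open>h\<close> at each common point, and these multiplicities add up to d.\<close>

lemma card_over_le:
  assumes "poly g b = poly gs z"
  shows "card (common b z) \<le> gcd (root_mult g b) (root_mult gs z)"
proof -
  let ?e = "root_mult g b" and ?d = "root_mult gs z"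
  define q where "q = ?d div gcd ?e ?d"
  have gp: "gcd ?e ?d > 0" using pos by auto
  have dq: "?d = q * gcd ?e ?d" unfolding q_def by simp
  have le: "q \<le> root_mult h a" if a: "a \<in> common b z" for a
  proof -
    have "?e * root_mult h a = ?d * root_mult hs a"
      using root_mult_f[of a] root_mult_f'[of a] a by (simp add: common_def)
    then have "?d dvd ?e * root_mult h a" by simp
    moreover define G where "G = gcd ?e ?d"
    moreover define t where "t = ?e div G"
    ultimately have "q * G dvd t * G * root_mult h a" using dq by (metis dvd_div_mult_self gcd_dvd1)
    then have "G * q dvd G * (t * root_mult h a)" by (simp only: mult_ac)
    then have "q dvd ?e div gcd ?e ?d * root_mult h a"
      using gp by (auto simp: G_def t_def)
    moreover have "coprime q (?e div gcd ?e ?d)"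
      unfolding q_def using gp by (simp add: div_gcd_coprime coprime_commute)
    ultimately have "q dvd root_mult h a" by (simp add: coprime_dvd_mult_right_iff)
    then show ?thesis using pos by (auto intro: dvd_imp_le)
  qed
  have "card (common b z) * q \<le> (\<Sum>a\<in>common b z. root_mult h a)"
    using sum_mono[of "common b z" "\<lambda>_. q", OF le] by simp
  also have "\<dots> = gcd ?e ?d * q" using sum_over[OF assms] dq by (simp only: mult.commute)
  finally show ?thesis using dq pos(3)[of z] by (metis mult_is_0 mult_le_cancel2 neq0_conv)
qed

lemma defect_over:
  assumes "poly g b = poly gs z"
  shows "(\<Sum>a\<in>common b z. root_mult h a - 1) = root_mult gs z - card (common b z)"
    "card (common b z) \<le> root_mult gs z"
proof -
  have "(\<Sum>a\<in>common b z. root_mult h a) = (\<Sum>a\<in>common b z. (root_mult h a - 1) + 1)"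
    by (rule sum.cong) (use pos in \<open>auto simp: Suc_pred'\<close>)
  also have "\<dots> = (\<Sum>a\<in>common b z. root_mult h a - 1) + card (common b z)"
    by (simp only: sum.distrib card_eq_sum)
  finally have "root_mult gs z = (\<Sum>a\<in>common b z. root_mult h a - 1) + card (common b z)"
    using sum_over[OF assms] by simp
  then show "(\<Sum>a\<in>common b z. root_mult h a - 1) = root_mult gs z - card (common b z)"
    "card (common b z) \<le> root_mult gs z" by auto
qed

lemma column_eq:
  "(\<Sum>a | poly hs a = z. root_mult h a - 1) = (\<Sum>b | poly g b = poly gs z. \<Sum>a\<in>common b z. root_mult h a - 1)"
proof -
  have "{a. poly hs a = z} = (\<Union>b\<in>{b. poly g b = poly gs z}. common b z)"
    using eq_at by (auto simp: common_def)
  then show ?thesis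
    using finite_poly_fibre[OF at_g] finite_over
    by (simp only:) (subst sum.UNION_disjoint, auto simp: common_def)
qed

text \<open>Splitting the points over \<open>z\<close> by their \<open>h\<close>-value b, each group
  carries ramification at least d - gcd(e, d), with e the multiplicity of \<open>g\<close> at b and
  d that of \<open>gs\<close> at \<open>z\<close>. The values e add up to the prime
  \<open>p\<close>, so \<open>defect_bound\<close> applies and also describes the case of
  equality.\<close>

lemma column_bound:
  assumes d: "1 < root_mult gs z"
  shows "root_mult gs z - 1 \<le> (\<Sum>a | poly hs a = z. root_mult h a - 1)"
    and "(\<Sum>a | poly hs a = z. root_mult h a - 1) = root_mult gs z - 1 \<Longrightarrow>
      \<exists>b0. poly g b0 = poly gs z \<and> \<not> root_mult gs z dvd root_mult g b0 \<and> coprime (root_mult g b0) (root_mult gs z) \<and>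
          (\<Sum>a\<in>common b0 z. root_mult h a - 1) = root_mult gs z - 1 \<and>
          (\<forall>b. poly g b = poly gs z \<longrightarrow> b \<noteq> b0 \<longrightarrow> root_mult gs z dvd root_mult g b \<and> (\<Sum>a\<in>common b z. root_mult h a - 1) = 0)"
proof -
  let ?B = "{b. poly g b = poly gs z}" and ?x = "\<lambda>b. \<Sum>a\<in>common b z. root_mult h a - 1"
  have x: "root_mult gs z \<le> ?x b + gcd (root_mult g b) (root_mult gs z)" if "b \<in> ?B" for b
    using defect_over[of b z] card_over_le[of b z] that by simp
  have sm: "sum (root_mult g) ?B = p" by (rule sum_root_mult_fibre[OF at_g])
  have fin: "finite ?B" by (rule finite_poly_fibre[OF at_g])
  note D = defect_bound[where B = ?B and x = ?x, OF fin prime sm d root_mult_less[OF at_gs]]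
  show "root_mult gs z - 1 \<le> (\<Sum>a | poly hs a = z. root_mult h a - 1)"
    unfolding column_eq by (rule D(1)) (rule x)
  assume "(\<Sum>a | poly hs a = z. root_mult h a - 1) = root_mult gs z - 1"
  then have "sum ?x ?B = root_mult gs z - 1" unfolding column_eq .
  then obtain b0 where "b0 \<in> ?B"
    "\<not> root_mult gs z dvd root_mult g b0 \<and> coprime (root_mult g b0) (root_mult gs z) \<and>
      ?x b0 = root_mult gs z - 1 \<and> (\<forall>b\<in>?B - {b0}. root_mult gs z dvd root_mult g b \<and> ?x b = 0)"
    using D(2)[OF x] by metis
  then show "\<exists>b0. poly g b0 = poly gs z \<and> \<not> root_mult gs z dvd root_mult g b0 \<and> coprime (root_mult g b0) (root_mult gs z) \<and>
          ?x b0 = root_mult gs z - 1 \<and>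
          (\<forall>b. poly g b = poly gs z \<longrightarrow> b \<noteq> b0 \<longrightarrow> root_mult gs z dvd root_mult g b \<and> ?x b = 0)"
    by (intro exI[of _ b0]) simp
qed

text \<open>The total ramifications of \<open>h\<close> and \<open>gs\<close> agree by the degree computation, so none of the
  column bounds is strict.\<close>

lemma column_tight:
  assumes d: "1 < root_mult gs z"
  shows "(\<Sum>a | poly hs a = z. root_mult h a - 1) = root_mult gs z - 1"
proof -
  let ?Z = "{z. 1 < root_mult gs z}" and ?C = "{a. 1 < root_mult h a}"
  let ?col = "\<lambda>z. \<Sum>a | poly hs a = z. root_mult h a - 1"
  have finZ: "finite ?Z" and finC: "finite ?C"
    using finite_critical_points[OF at_gs] finite_critical_points[OF at_h] by auto
  let ?U = "\<Union>z\<in>?Z. {a. poly hs a = z}"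
  have finU: "finite ?U" using finZ finite_poly_fibre[OF at_hs] by auto
  have "sum ?col ?Z = (\<Sum>a\<in>?U. root_mult h a - 1)"
    using finZ finite_poly_fibre[OF at_hs] by (subst sum.UNION_disjoint) auto
  also have "\<dots> = (\<Sum>a\<in>?U \<inter> ?C. root_mult h a - 1)"
    by (rule sum.mono_neutral_right[OF finU]) auto
  also have "\<dots> \<le> (\<Sum>a\<in>?C. root_mult h a - 1)"
    by (rule sum_mono2[OF finC]) auto
  also have "\<dots> = (\<Sum>z\<in>?Z. root_mult gs z - 1)"
    using sum_ramification[OF at_h] sum_ramification[OF at_gs] degrees by simp
  finally have le: "sum ?col ?Z \<le> (\<Sum>z\<in>?Z. root_mult gs z - 1)" .
  have ge: "\<And>z. z \<in> ?Z \<Longrightarrow> root_mult gs z - 1 \<le> ?col z" using column_bound(1) by auto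
  have "root_mult gs z - 1 = ?col z" 
    by (rule sum_mono_inv[OF antisym[OF sum_mono[OF ge] le] ge]) (use d finZ in auto)
  then show ?thesis by simp
qed

text \<open>The equality case of the column bound: all ramification of \<open>h\<close> above
  \<open>z\<close> sits over one value \<open>b0\<close>, and its amount leaves room for only one
  point there. Over every other value each summand is zero, so \<open>h\<close> is
  unramified.\<close>

theorem over_ramified:
  assumes d: "1 < root_mult gs z"
  shows "\<exists>b0. poly g b0 = poly gs z \<and> \<not> root_mult gs z dvd root_mult g b0 \<and>
     coprime (root_mult g b0) (root_mult gs z) \<and>
     (\<exists>a. common b0 z = {a} \<and> root_mult h a = root_mult gs z) \<and>
     (\<forall>b. poly g b = poly gs z \<longrightarrow> b \<noteq> b0 \<longrightarrow>
        root_mult gs z dvd root_mult g b \<and> (\<forall>a\<in>common b z. root_mult h a = 1))"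
proof -
  obtain b0 where b0: "poly g b0 = poly gs z" "\<not> root_mult gs z dvd root_mult g b0"
    "coprime (root_mult g b0) (root_mult gs z)"
    "(\<Sum>a\<in>common b0 z. root_mult h a - 1) = root_mult gs z - 1"
    "\<And>b. poly g b = poly gs z \<Longrightarrow> b \<noteq> b0 \<Longrightarrow> root_mult gs z dvd root_mult g b \<and> (\<Sum>a\<in>common b z. root_mult h a - 1) = 0"
    using column_bound(2)[OF d column_tight[OF d]] by blast
  have "card (common b0 z) = 1" using defect_over[OF b0(1)] b0(4) d by linarith
  then obtain a where a: "common b0 z = {a}" by (auto simp: card_1_singleton_iff)
  then have "root_mult h a = root_mult gs z" using sum_over[OF b0(1)] by simp
  moreover have "root_mult h x = 1" if "poly g b = poly gs z" "b \<noteq> b0" "x \<in> common b z" for b x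
  proof -
    have "root_mult h x - 1 = 0" using b0(5)[OF that(1,2)] that(3) finite_over by auto
    then show ?thesis using pos(2)[of x] by simp
  qed
  ultimately show ?thesis using a b0 by blast
qed

lemma over_unramified:
  assumes "root_mult gs z = 1" "poly g b = poly gs z"
  shows "\<exists>a. common b z = {a} \<and> root_mult h a = 1"
proof -
  have "card (common b z) \<le> 1" using defect_over(2)[OF assms(2)] assms(1) by simp
  moreover have "common b z \<noteq> {}" using sum_over[OF assms(2)] assms(1) by auto
  ultimately have "card (common b z) = 1" using finite_over by (metis One_nat_def Suc_leI antisym card_gt_0_iff)
  then obtain a where "common b z = {a}" by (auto simp: card_1_singleton_iff)
  then show ?thesis using sum_over[OF assms(2)] assms(1) by auto
qed

end

text \<open>The profile u, M, ..., M shared by the two fibres over \<open>c\<close>;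
  \<open>b0\<close> and \<open>z0\<close> are the points carrying the exceptional u. The final
  disjunction is the germ of the dichotomy: u = 1 leads to case (i), and u > 1 with two-point fibres
  to case (ii).\<close>

definition matching_fibres :: "'a::alg_closed_field poly \<Rightarrow> 'a poly \<Rightarrow> 'a \<Rightarrow> nat \<Rightarrow> nat \<Rightarrow> 'a \<Rightarrow> 'a \<Rightarrow> bool" where
  "matching_fibres g gs c u M b0 z0 \<longleftrightarrow> 0 < u \<and> u < M \<and> coprime u M \<and>
     poly g b0 = c \<and> poly gs z0 = c \<and> root_mult g b0 = u \<and> root_mult gs z0 = u \<and>
     (\<forall>b. poly g b = c \<longrightarrow> b \<noteq> b0 \<longrightarrow> root_mult g b = M) \<and>
     (\<forall>z. poly gs z = c \<longrightarrow> z \<noteq> z0 \<longrightarrow> root_mult gs z = M) \<and>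
     card {b. poly g b = c} = card {z. poly gs z = c} \<and> (u = 1 \<or> card {b. poly g b = c} = 2)"

lemma matching_fibres_swap: "matching_fibres g gs c u M b0 z0 \<Longrightarrow> matching_fibres gs g c u M z0 b0"
  by (auto simp: matching_fibres_def)

context collision
begin

lemma matching_fibres_exist:
  assumes "1 < root_mult g b"
  shows "\<exists>u M b0 z0. matching_fibres g gs (poly g b) u M b0 z0"
proof -
  let ?c = "poly g b"
  let ?E = "{b. poly g b = ?c}" and ?E' = "{z. poly gs z = ?c}"
  have "\<exists>u M. \<exists>b0\<in>?E. \<exists>z0\<in>?E'. 0 < u \<and> u < M \<and> coprime u M \<and> root_mult g b0 = u \<and> root_mult gs z0 = u \<and>
    (\<forall>b\<in>?E - {b0}. root_mult g b = M) \<and> (\<forall>z\<in>?E' - {z0}. root_mult gs z = M) \<and> card ?E = card ?E' \<and> (u = 1 \<or> card ?E = 2)"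
  proof (rule two_profiles)
    show "finite ?E" "finite ?E'" using finite_poly_fibre[OF at_g] finite_poly_fibre[OF at_gs] by auto
    show "sum (root_mult g) ?E = p" "sum (root_mult gs) ?E' = p"
      using sum_root_mult_fibre[OF at_g] sum_root_mult_fibre[OF at_gs] by auto
    show "\<exists>b0\<in>?E. coprime (root_mult g b0) (root_mult gs z) \<and> (\<forall>b\<in>?E - {b0}. root_mult gs z dvd root_mult g b)"
      if "z \<in> ?E'" "1 < root_mult gs z" for z
      using over_ramified[OF that(2)] that(1) by fastforce
    show "\<exists>z0\<in>?E'. coprime (root_mult gs z0) (root_mult g b) \<and> (\<forall>z\<in>?E' - {z0}. root_mult g b dvd root_mult gs z)"
      if "b \<in> ?E" "1 < root_mult g b" for b
      using collision.over_ramified[OF swap that(2)] that(1) by fastforce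
  qed (use pos assms root_mult_less[OF at_g] root_mult_less[OF at_gs] in auto)
  then show ?thesis unfolding matching_fibres_def by (elim exE bexE conjE) (intro exI conjI; (assumption | blast | simp))
qed

text \<open>For u = 1 the parts M \<ge> 2 fill p - 1; otherwise the fibre has two points and p = u +
  M. Either way the bound says that a critical fibre accounts for ramification of at least (p -
  1)/2, which rules out a second one.\<close>

lemma matching_fibres_card:
  assumes "matching_fibres g gs c u M b0 z0"
  shows "p = (card {b. poly g b = c} - 1) * M + u" "2 * card {b. poly g b = c} \<le> p + 1" "card {b. poly g b = c} \<ge> 2"
proof -
  let ?E = "{b. poly g b = c}"
  have fin: "finite ?E" using finite_poly_fibre[OF at_g] by auto
  have b0: "b0 \<in> ?E" using assms by (auto simp: matching_fibres_def)
  have "p = u + (\<Sum>b\<in>?E - {b0}. root_mult g b)"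
    using sum_root_mult_fibre[OF at_g, of c] sum.remove[OF fin b0, of "root_mult g"] assms
    by (auto simp: matching_fibres_def)
  also have "(\<Sum>b\<in>?E - {b0}. root_mult g b) = (\<Sum>b\<in>?E - {b0}. M)"
    by (rule sum.cong) (use assms in \<open>auto simp: matching_fibres_def\<close>)
  also have "\<dots> = (card ?E - 1) * M" using fin b0 by simp
  finally show 1: "p = (card ?E - 1) * M + u" by simp
  have u: "0 < u" "u < M" "u = 1 \<or> card ?E = 2" using assms by (auto simp: matching_fibres_def)
  have "u < p" using root_mult_less[OF at_g, of b0] assms by (auto simp: matching_fibres_def)
  then have "(card ?E - 1) * M \<noteq> 0" using 1 by linarith
  then show c2: "card ?E \<ge> 2" by auto
  show "2 * card ?E \<le> p + 1"
  proof (cases "u = 1")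
    case True
    then have "(card ?E - 1) * 2 \<le> (card ?E - 1) * M" using u by (intro mult_le_mono2) simp
    then show ?thesis using 1 True c2 by linarith
  next
    case False
    then show ?thesis using 1 u by auto
  qed
qed

text \<open>A critical fibre of n points contributes p - n to the degree of g', and 2n \<le> p + 1.
  Two such fibres would contribute at least p - 1, but that degree is below p - 1.\<close>

lemma critical_value_unique:
  assumes "1 < root_mult g b" "1 < root_mult g b'"
  shows "poly g b = poly g b'"
proof (rule ccontr)
  assume ne: "poly g b \<noteq> poly g b'"
  let ?E = "\<lambda>c. {b. poly g b = c}" and ?C = "{b. 1 < root_mult g b}"
  have fin: "finite (?E c)" for c using finite_poly_fibre[OF at_g] by auto
  have s: "(\<Sum>b\<in>?E c \<inter> ?C. root_mult g b - 1) + card (?E c) = p" for c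
  proof -
    have "p = (\<Sum>b\<in>?E c. (root_mult g b - 1) + 1)"
      unfolding sum_root_mult_fibre[OF at_g, of c, symmetric] using pos by (intro sum.cong) (auto simp: Suc_pred')
    also have "\<dots> = (\<Sum>b\<in>?E c. root_mult g b - 1) + card (?E c)" by (simp only: sum.distrib card_eq_sum)
    also have "(\<Sum>b\<in>?E c. root_mult g b - 1) = (\<Sum>b\<in>?E c \<inter> ?C. root_mult g b - 1)"
      by (rule sum.mono_neutral_right[OF fin]) auto
    finally show ?thesis by simp
  qed
  have cd: "2 * card (?E (poly g x)) \<le> p + 1" if "1 < root_mult g x" for x
    using matching_fibres_exist[OF that] matching_fibres_card(2) by blast
  have finC: "finite ?C" by (rule finite_critical_points[OF at_g])
  have "(\<Sum>x\<in>?E (poly g b) \<inter> ?C. root_mult g x - 1) + (\<Sum>x\<in>?E (poly g b') \<inter> ?C. root_mult g x - 1)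
     = (\<Sum>x\<in>(?E (poly g b) \<inter> ?C) \<union> (?E (poly g b') \<inter> ?C). root_mult g x - 1)"
    by (rule sum.union_disjoint[symmetric]) (use finC ne in auto)
  also have "\<dots> \<le> (\<Sum>x\<in>?C. root_mult g x - 1)"
    by (rule sum_mono2[OF finC]) auto
  also have "\<dots> = degree (pderiv g)" by (rule sum_ramification[OF at_g])
  also have "\<dots> < p - 1" by (rule degree_pderiv_monic_less[OF prime CHAR g])
  finally show False using s[of "poly g b"] s[of "poly g b'"] cd[OF assms(1)] cd[OF assms(2)] by linarith
qed

end

section \<open>Shapes over an algebraically closed field\<close>

definition type_i :: "'a::idom poly \<Rightarrow> 'a \<Rightarrow> nat \<Rightarrow> bool" where
  "type_i P w M \<longleftrightarrow> root_mult P w = 1 \<and> (\<forall>a. poly P a = poly P w \<longrightarrow> a \<noteq> w \<longrightarrow> root_mult P a = M) \<and>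
     (\<forall>a. 1 < root_mult P a \<longrightarrow> poly P a = poly P w)"

text \<open>The exponents are exchanged between the components: at \<open>w\<close> they are r for
  \<open>g\<close> and p - r for \<open>h\<close>, at \<open>v\<close> the reverse. So the
  composition has multiplicity r * (p - r) at both points, and it cannot tell them apart by
  multiplicity.\<close>

definition type_ii :: "nat \<Rightarrow> 'a::idom poly \<Rightarrow> 'a poly \<Rightarrow> 'a \<Rightarrow> nat \<Rightarrow> bool" where
  "type_ii p g h w r \<longleftrightarrow> 1 < r \<and> r < p - 1 \<and> root_mult g (poly h w) = r \<and> root_mult h w = p - r \<and>
     (\<forall>a. poly h a = poly h w \<longrightarrow> a \<noteq> w \<longrightarrow> root_mult h a = 1) \<and>
     (\<exists>v. poly h v \<noteq> poly h w \<and> root_mult g (poly h v) = p - r \<and>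
        {b. poly g b = poly g (poly h w)} = {poly h w, poly h v} \<and> root_mult h v = r \<and>
        (\<forall>a. poly h a = poly h v \<longrightarrow> a \<noteq> v \<longrightarrow> root_mult h a = 1))"

lemma card_2_other: "card S = 2 \<Longrightarrow> x \<in> S \<Longrightarrow> \<exists>y. S = {x, y} \<and> y \<noteq> x"
  by (metis card_2_iff insert_commute insertE singletonD)

context collision
begin

text \<open>If \<open>gs\<close> is ramified at \<open>z\<close>, then \<open>b\<close> is not the
  exceptional value in \<open>over_ramified\<close>, since divisibility fails there.\<close>

lemma common_dvd:
  assumes "poly g b = poly gs z" "root_mult gs z dvd root_mult g b" "a \<in> common b z"
  shows "root_mult h a = 1"
proof (cases "root_mult gs z = 1")
  case True
  then show ?thesis using over_unramified[OF True assms(1)] assms(3) by auto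
next
  case False
  then have "1 < root_mult gs z" using pos(3)[of z] by linarith
  then show ?thesis using over_ramified assms by metis
qed

lemma common_not_dvd:
  assumes "poly g b = poly gs z" "\<not> root_mult gs z dvd root_mult g b"
  shows "\<exists>a. common b z = {a} \<and> root_mult h a = root_mult gs z"
proof -
  have "root_mult gs z \<noteq> 1" using assms(2) by auto
  then have "1 < root_mult gs z" using pos(3)[of z] by linarith
  then show ?thesis using over_ramified assms by metis
qed

context
  fixes c u M b0 z0
  assumes mf: "matching_fibres g gs c u M b0 z0"
begin

lemma matching_fibresD: "0 < u" "u < M" "coprime u M" "poly g b0 = c" "poly gs z0 = c" "root_mult g b0 = u" "root_mult gs z0 = u"
  "\<And>b. poly g b = c \<Longrightarrow> b \<noteq> b0 \<Longrightarrow> root_mult g b = M"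
  "\<And>z. poly gs z = c \<Longrightarrow> z \<noteq> z0 \<Longrightarrow> root_mult gs z = M"
  using mf unfolding matching_fibres_def by blast+

lemma not_M_dvd_u: "\<not> M dvd u"
  using matching_fibresD(1,2) by (auto dest: dvd_imp_le)

lemma ex_other_b: "\<exists>b. poly g b = c \<and> b \<noteq> b0"
proof (rule ccontr)
  assume "\<not> ?thesis"
  then have "{b. poly g b = c} \<subseteq> {b0}" by blast
  then have "card {b. poly g b = c} \<le> card {b0}" by (intro card_mono) auto
  then show False using matching_fibres_card(3)[OF mf] by simp
qed

lemma critical_g: "1 < root_mult g b \<Longrightarrow> poly g b = c"
proof -
  assume b: "1 < root_mult g b"
  obtain b1 where b1: "poly g b1 = c" "b1 \<noteq> b0" using ex_other_b by blast
  then have "1 < root_mult g b1" using matching_fibresD(1,2) matching_fibresD(8)[OF b1] by simp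
  then show ?thesis using critical_value_unique[OF b] b1 by simp
qed

text \<open>Shows that \<open>u\<close> and \<open>M\<close> depend only on \<open>g\<close> and
  \<open>c\<close>, not on the decomposition with which \<open>g\<close> is paired.\<close>

lemma image_root_mult_g: "root_mult g ` {b. poly g b = c} = {u, M}"
proof -
  obtain b1 where b1: "poly g b1 = c" "b1 \<noteq> b0" using ex_other_b by blast
  show ?thesis
  proof (intro equalityI subsetI)
    fix x assume "x \<in> root_mult g ` {b. poly g b = c}"
    then show "x \<in> {u, M}" using matching_fibresD(6,8) by blast
  next
    fix x assume "x \<in> {u, M}"
    then show "x \<in> root_mult g ` {b. poly g b = c}" using matching_fibresD(4,6) matching_fibresD(8)[OF b1] b1(1) by blast
  qed
qed

lemma ex_critical_f: "\<exists>a. 1 < root_mult f a"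
proof -
  obtain b1 where b1: "poly g b1 = c" "b1 \<noteq> b0" using ex_other_b by blast
  have "degree (h - [:b1:]) > 0" using degree_minus_const[OF at_h] p_gt_1 by simp
  then obtain a where a: "poly (h - [:b1:]) a = 0" using alg_closed_imp_poly_has_root by blast
  then have "root_mult f a = M * root_mult h a" using root_mult_f[of a] matching_fibresD(8)[OF b1] by simp
  moreover have "M * 1 \<le> M * root_mult h a" using pos(2)[of a] by (intro mult_le_mono2) simp
  ultimately have "1 < root_mult f a" using matching_fibresD(1,2) by linarith
  then show ?thesis by blast
qed

end

text \<open>A critical point of \<open>f\<close> is critical for \<open>h\<close> or lies over a
  critical point of \<open>g\<close>. If only \<open>h\<close> is ramified there, then
  \<open>gs\<close> must be ramified at the corresponding point, and \<open>c\<close> is its sole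
  critical value too. With \<open>ex_critical_f\<close>, this makes \<open>c\<close> an invariant of
  \<open>f\<close>.\<close>

lemma critical_f:
  assumes mf: "matching_fibres g gs c u M b0 z0" and a: "1 < root_mult f a"
  shows "poly f a = c"
proof (cases "1 < root_mult g (poly h a)")
  case True
  then show ?thesis using critical_g[OF mf] by (simp add: poly_pcompose)
next
  case False
  then have "root_mult g (poly h a) = 1" using pos(1)[of "poly h a"] by linarith
  then have k: "root_mult h a > 1" using a root_mult_f[of a] by simp
  have "a \<in> common (poly h a) (poly hs a)" by (simp add: common_def)
  then have "\<not> root_mult gs (poly hs a) dvd root_mult g (poly h a)"
    using common_dvd[OF eq_at] k by auto
  then have "root_mult gs (poly hs a) \<noteq> 1" by auto
  then have "1 < root_mult gs (poly hs a)" using pos(3)[of "poly hs a"] by linarith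
  then show ?thesis
    using collision.critical_g[OF swap matching_fibres_swap[OF mf]] eq_at by (simp add: poly_pcompose)
qed

text \<open>The point \<open>w\<close> is described through \<open>f\<close> and \<open>c\<close>
  alone, so that the same \<open>w\<close> can be used for all decompositions.\<close>

lemma ex_simple_point:
  assumes mf: "matching_fibres g gs c u M b0 z0" and u: "u = 1"
  shows "\<exists>w. poly f w = c \<and> root_mult f w = 1"
proof -
  note m = matching_fibresD[OF mf]
  obtain w where w: "common b0 z0 = {w}" "root_mult h w = 1"
    using over_unramified[of z0 b0] m u by auto
  then have "poly h w = b0" by (auto simp: common_def)
  then show ?thesis using w m u root_mult_f[of w] by (intro exI[of _ w]) (simp add: poly_pcompose)
qed

text \<open>Being unramified, \<open>w\<close> is the only point over (b0, z0). The other points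
  with \<open>h\<close>-value \<open>b0\<close> lie over some z with multiplicity M, which does not
  divide 1, so \<open>h\<close> takes multiplicity M. A critical point of \<open>h\<close> over
  another value would lie over (b, z) with multiplicity M on both sides, where \<open>h\<close> is
  unramified.\<close>

lemma type_i_g_h:
  assumes mf: "matching_fibres g gs c u M b0 z0" and u: "u = 1"
    and w: "poly f w = c" "root_mult f w = 1"
  shows "type_i g (poly h w) M" "type_i h w M"
proof -
  note m = matching_fibresD[OF mf]
  have M1: "1 < M" using m u by simp
  have c: "poly g (poly h w) = c" using w by (simp add: poly_pcompose)
  have e1: "root_mult g (poly h w) = 1" "root_mult h w = 1"
    using w(2) root_mult_f[of w] by auto
  have e2: "root_mult gs (poly hs w) = 1" using w(2) root_mult_f'[of w] by auto
  have hw: "poly h w = b0" using m(8)[OF c] e1 M1 by force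
  have hsw: "poly hs w = z0" using m(9)[of "poly hs w"] eq_at[of w] c e2 M1 by force
  show "type_i g (poly h w) M"
    unfolding type_i_def using e1 hw m critical_g[OF mf] by auto
  show "type_i h w M"
    unfolding type_i_def
  proof (intro conjI allI impI)
    show "root_mult h w = 1" by (rule e1)
    fix a
    show "root_mult h a = M" if a: "poly h a = poly h w" "a \<noteq> w"
    proof (cases "poly hs a = z0")
      case True
      obtain y where "common b0 z0 = {y}" using over_unramified[of z0 b0] m u by auto
      moreover have "a \<in> common b0 z0" "w \<in> common b0 z0" using True a hw hsw by (auto simp: common_def)
      ultimately show ?thesis using a(2) by auto
    next
      case False
      have gz: "poly g b0 = poly gs (poly hs a)" using eq_at[of a] a hw by simp
      have M: "root_mult gs (poly hs a) = M" using m(9)[of "poly hs a"] False gz m(4) by simp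
      have "\<not> M dvd root_mult g b0" using m u M1 by simp
      then obtain y where "common b0 (poly hs a) = {y}" "root_mult h y = M"
        using common_not_dvd[OF gz] M by auto
      moreover have "a \<in> common b0 (poly hs a)" using a hw by (auto simp: common_def)
      ultimately show ?thesis by auto
    qed
    show "poly h a = poly h w" if a: "1 < root_mult h a"
    proof (rule ccontr)
      assume ne: "poly h a \<noteq> poly h w"
      have "a \<in> common (poly h a) (poly hs a)" by (simp add: common_def)
      then have nd: "\<not> root_mult gs (poly hs a) dvd root_mult g (poly h a)"
        using common_dvd[OF eq_at] a by auto
      then have "root_mult gs (poly hs a) \<noteq> 1" by auto
      then have g1: "1 < root_mult gs (poly hs a)" using pos(3)[of "poly hs a"] by linarith
      then have "poly gs (poly hs a) = c"
        using collision.critical_g[OF swap matching_fibres_swap[OF mf]] by simp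
      then have cc: "poly g (poly h a) = c" using eq_at by simp
      have "root_mult gs (poly hs a) = M"
        using m(7,9) \<open>poly gs (poly hs a) = c\<close> g1 u by force
      moreover have "root_mult g (poly h a) = M" using m(8)[OF cc] ne hw by simp
      ultimately show False using nd by simp
    qed
  qed
qed

lemma two_fibres:
  assumes mf: "matching_fibres g gs c u M b0 z0" and u: "u \<noteq> 1"
  obtains b1 z1 where "{b. poly g b = c} = {b0, b1}" "{z. poly gs z = c} = {z0, z1}" "b1 \<noteq> b0" "z1 \<noteq> z0"
    "p = u + M"
proof -
  note m = matching_fibresD[OF mf]
  have cards: "card {b. poly g b = c} = 2" "card {z. poly gs z = c} = 2"
    using mf u by (auto simp: matching_fibres_def)
  have "\<exists>b1. {b. poly g b = c} = {b0, b1} \<and> b1 \<noteq> b0"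
    using m(4) by (intro card_2_other[OF cards(1)]) simp
  moreover have "\<exists>z1. {z. poly gs z = c} = {z0, z1} \<and> z1 \<noteq> z0"
    using m(5) by (intro card_2_other[OF cards(2)]) simp
  moreover have "p = u + M" using matching_fibres_card(1)[OF mf] cards by simp
  ultimately show ?thesis using that by blast
qed

text \<open>Of the four pairs over \<open>c\<close>, the multiplicities agree at (b0, z0) and (b1,
  z1), and \<open>h\<close> is unramified above them. At (b0, z1) and (b1, z0) they are coprime and
  greater than 1, and there is one point carrying the full multiplicity.\<close>

lemma points_ii:
  assumes mf: "matching_fibres g gs c u M b0 z0" and u: "u \<noteq> 1"
  obtains b1 z1 x y where "{b. poly g b = c} = {b0, b1}" "{z. poly gs z = c} = {z0, z1}" "b1 \<noteq> b0" "z1 \<noteq> z0"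
    "p = u + M" "root_mult g b1 = M" "common b0 z1 = {x}" "root_mult h x = M" "common b1 z0 = {y}" "root_mult h y = u"
    "\<And>a. a \<in> common b0 z0 \<Longrightarrow> root_mult h a = 1" "\<And>a. a \<in> common b1 z1 \<Longrightarrow> root_mult h a = 1"
proof -
  note m = matching_fibresD[OF mf]
  obtain b1 z1 where bz: "{b. poly g b = c} = {b0, b1}" "{z. poly gs z = c} = {z0, z1}" "b1 \<noteq> b0" "z1 \<noteq> z0" "p = u + M"
    using two_fibres[OF mf u] by blast
  have v: "poly g b1 = c" "poly gs z1 = c" using bz(1,2) by blast+
  have e: "root_mult g b1 = M" "root_mult gs z1 = M" using m(8)[OF v(1) bz(3)] m(9)[OF v(2) bz(4)] by auto
  have "\<not> u dvd M" using m(3) u by (metis coprime_common_divisor_nat dvd_refl)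
  then obtain y where y: "common b1 z0 = {y}" "root_mult h y = u"
    using common_not_dvd[of b1 z0] v m e by auto
  obtain x where x: "common b0 z1 = {x}" "root_mult h x = M"
    using common_not_dvd[of b0 z1] v m e not_M_dvd_u[OF mf] by auto
  have "\<And>a. a \<in> common b0 z0 \<Longrightarrow> root_mult h a = 1" "\<And>a. a \<in> common b1 z1 \<Longrightarrow> root_mult h a = 1"
    using common_dvd[of b0 z0] common_dvd[of b1 z1] m v e by auto
  then show ?thesis using that bz e x y by blast
qed

lemma ex_double_point:
  assumes mf: "matching_fibres g gs c u M b0 z0" and u: "u \<noteq> 1"
  shows "\<exists>w. poly f w = c \<and> root_mult f w = u * M"
proof -
  note m = matching_fibresD[OF mf]
  obtain b1 z1 x y where "common b0 z1 = {x}" "root_mult h x = M"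
    using points_ii[OF mf u] by metis
  then have "poly h x = b0" by (auto simp: common_def)
  then show ?thesis using \<open>root_mult h x = M\<close> m root_mult_f[of x]
    by (intro exI[of _ x]) (simp add: poly_pcompose)
qed

text \<open>Over \<open>c\<close>, \<open>f\<close> has multiplicity u * M exactly at the two points
  \<open>x\<close> and \<open>y\<close> where \<open>h\<close> is ramified, and u or M elsewhere. So
  \<open>w\<close> is one of them: w = x gives r = u, and w = y gives r = M = p - u.\<close>

lemma type_ii_g_h:
  assumes mf: "matching_fibres g gs c u M b0 z0" and u: "u \<noteq> 1"
    and w: "poly f w = c" "root_mult f w = u * M"
  shows "\<exists>r\<in>{u, p - u}. type_ii p g h w r"
proof -
  note m = matching_fibresD[OF mf]
  obtain b1 z1 x y where P: "{b. poly g b = c} = {b0, b1}" "{z. poly gs z = c} = {z0, z1}" "b1 \<noteq> b0" "z1 \<noteq> z0"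
    "p = u + M" "root_mult g b1 = M" "common b0 z1 = {x}" "root_mult h x = M" "common b1 z0 = {y}" "root_mult h y = u"
    "\<And>a. a \<in> common b0 z0 \<Longrightarrow> root_mult h a = 1" "\<And>a. a \<in> common b1 z1 \<Longrightarrow> root_mult h a = 1"
    using points_ii[OF mf u] by metis
  have u1: "1 < u" "1 < M" "u < p - 1" "M < p - 1" using u m P(5) by auto
  have v: "poly g b1 = c" using P(1) by blast
  have hx: "poly h x = b0" "poly h y = b1" using P(7,9) by (auto simp: common_def)
  have inE: "poly hs a \<in> {z0, z1}" if "poly h a = b0 \<or> poly h a = b1" for a
  proof -
    have "poly gs (poly hs a) = c" using that eq_at[of a] m(4) v by auto
    then show ?thesis using P(2) by blast
  qed
  have o0: "root_mult h a = 1" if "poly h a = b0" "a \<noteq> x" for a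
  proof -
    have "a \<in> common b0 z0 \<or> a \<in> common b0 z1" using inE[of a] that by (auto simp: common_def)
    then show ?thesis using P(7,11) that by blast
  qed
  have o1: "root_mult h a = 1" if "poly h a = b1" "a \<noteq> y" for a
  proof -
    have "a \<in> common b1 z0 \<or> a \<in> common b1 z1" using inE[of a] that by (auto simp: common_def)
    then show ?thesis using P(9,12) that by blast
  qed
  have "poly h w \<in> {b0, b1}" using w(1) P(1) by (auto simp: poly_pcompose)
  moreover have "w = x" if "poly h w = b0"
    using o0[OF that] root_mult_f[of w] w(2) that m(6) u1 by fastforce
  moreover have "w = y" if "poly h w = b1"
    using o1[OF that] root_mult_f[of w] w(2) that P(6) u1 by fastforce
  ultimately consider "w = x" | "w = y" by blast
  then show ?thesis
  proof cases
    case 1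
    have "type_ii p g h w u"
      unfolding type_ii_def using 1 u1 m P hx o0 o1 by (intro conjI exI[of _ y]) auto
    then show ?thesis by blast
  next
    case 2
    have "type_ii p g h w M"
      unfolding type_ii_def using 2 u1 m P hx o0 o1 v by (intro conjI exI[of _ x]) auto
    then show ?thesis using P(5) by auto
  qed
qed

end

section \<open>Explicit polynomials recovered from multiplicities\<close>

lemma alg_closed_prod_roots:
  fixes P :: "'a::alg_closed_field poly"
  assumes "P \<noteq> 0"
  shows "P = smult (lead_coeff P) (\<Prod>a | poly P a = 0. [:- a, 1:] ^ order a P)"
proof -
  have "(\<Prod>x\<in>#proots P. [:- x, 1:]) = (\<Prod>a | poly P a = 0. [:- a, 1:] ^ order a P)"
    using assms by (subst image_prod_mset_multiplicity) simp
  then show ?thesis using alg_closed_proots(2)[OF assms] by simp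
qed

lemma prod_root_mult:
  fixes P :: "'a::alg_closed_field poly"
  assumes "degree P > 0" "lead_coeff P = 1"
  shows "P - [:c:] = (\<Prod>a | poly P a = c. [:- a, 1:] ^ root_mult P a)"
proof -
  have nz: "P - [:c:] \<noteq> 0" using minus_const_neq_0[OF assms(1)] .
  have "degree (P - [:c:]) = degree P" using assms(1)
    by (metis add_uminus_conv_diff degree_add_eq_left degree_minus degree_pCons_0)
  then have lc: "lead_coeff (P - [:c:]) = 1" using assms
    by (simp add: coeff_pCons split: nat.split)
  show ?thesis
    by (subst alg_closed_prod_roots[OF nz], subst lc) (auto simp: root_mult_def intro!: prod.cong)
qed

lemma shift_poly_eq: "shift_poly w P = pcompose P [:w, 1:] - [:poly P w:]"
  by (simp add: shift_poly_def pcompose_pCons)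

lemma shift_poly_eq': "shift_poly w P = pcompose (P - [:poly P w:]) [:w, 1:]"
  by (simp add: shift_poly_eq pcompose_diff)

lemma pcompose_linear_power: "pcompose (P ^ n) q = pcompose P q ^ n"
  by (induction n) (simp_all add: pcompose_mult pcompose_1)

text \<open>The cofactor \<open>T\<close> satisfies \<open>T + M (x - w) T' = const\<close>, which kills all coefficients of \<open>T\<close>
  around \<open>w\<close> but the extreme ones.\<close>

theorem shift_poly_type_i:
  fixes P :: "'a::alg_closed_field poly"
  assumes p: "prime p" "CHAR('a) = p" and P: "lead_coeff P = 1" "degree P = p" "pderiv P \<noteq> 0"
    and t: "type_i P w M" and M: "1 < M"
  shows "\<exists>a l. a \<noteq> 0 \<and> M * l = p - 1 \<and> shift_poly w P = [:0, 1:] * ([:0, 1:] ^ l - [:a:]) ^ M"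
proof -
  have p0: "p > 1" using p prime_gt_1_nat by auto
  let ?S = "{a. poly P a = poly P w}"
  define S' where "S' = ?S - {w}"
  define l where "l = card S'"
  define T where "T = (\<Prod>a\<in>S'. [:- a, 1:])"
  have fin: "finite ?S" using finite_poly_fibre[OF p P(2,3)] by simp
  have finS': "finite S'" using fin by (simp add: S'_def)
  have w1: "root_mult P w = 1" and wM: "\<And>a. a \<in> S' \<Longrightarrow> root_mult P a = M"
    using t by (auto simp: type_i_def S'_def)
  have "p = 1 + (\<Sum>a\<in>S'. root_mult P a)"
    using sum_root_mult_fibre[OF p P(2,3), of "poly P w"] sum.remove[OF fin, of w "root_mult P"] w1
    by (simp add: S'_def)
  also have "(\<Sum>a\<in>S'. root_mult P a) = (\<Sum>a\<in>S'. M)" by (rule sum.cong) (use wM in auto)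
  finally have pl: "p = 1 + l * M" by (simp add: l_def)
  have PT: "P - [:poly P w:] = [:- w, 1:] * T ^ M"
  proof -
    have "P - [:poly P w:] = (\<Prod>a\<in>?S. [:- a, 1:] ^ root_mult P a)"
      by (rule prod_root_mult) (use P p0 in auto)
    also have "\<dots> = [:- w, 1:] ^ root_mult P w * (\<Prod>a\<in>S'. [:- a, 1:] ^ root_mult P a)"
      using prod.remove[OF fin, of w] by (simp add: S'_def del: mult_pCons_left)
    also have "(\<Prod>a\<in>S'. [:- a, 1:] ^ root_mult P a) = (\<Prod>a\<in>S'. [:- a, 1:] ^ M)"
      by (rule prod.cong) (use wM in auto)
    also have "\<dots> = T ^ M" by (simp add: T_def prod_power_distrib)
    finally show ?thesis by (simp add: w1 del: mult_pCons_left)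
  qed
  have degT: "degree T = l" unfolding T_def l_def
    by (subst degree_prod_eq_sum_degree) auto
  have T0: "T \<noteq> 0" unfolding T_def using finS' by (auto simp: prod_zero_iff)
  have lcT: "lead_coeff T = 1" unfolding T_def lead_coeff_prod by simp
  obtain m where m: "M = Suc m" using M by (cases M) auto
  define K where "K = T + smult (of_nat M) ([:- w, 1:] * pderiv T)"
  have dP: "pderiv P = T ^ m * K"
  proof -
    have "pderiv P = pderiv (P - [:poly P w:])" by (simp add: pderiv_diff)
    also have "\<dots> = [:- w, 1:] * (smult (of_nat M) (T ^ m) * pderiv T) + T ^ M * pderiv [:- w, 1:]"
      unfolding PT m pderiv_mult pderiv_power_Suc by simp
    also have "pderiv [:- w, 1:] = 1" by (simp add: pderiv_pCons)
    also have "[:- w, 1:] * (smult (of_nat M) (T ^ m) * pderiv T) + T ^ M * 1 = T ^ m * K"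
      unfolding K_def m power_Suc
      by (simp only: distrib_left mult_smult_right mult_smult_left mult_ac add_ac mult_1_right mult_1_left)
    finally show ?thesis .
  qed
  have crit: "{a. 1 < root_mult P a} = S'"
  proof (intro equalityI subsetI)
    fix a assume "a \<in> {a. 1 < root_mult P a}"
    then have "1 < root_mult P a" by simp
    moreover from this have "poly P a = poly P w" using t unfolding type_i_def by blast
    ultimately show "a \<in> S'" using w1 by (auto simp: S'_def)
  qed (use wM M in simp)
  \<comment> \<open>Every critical point is a root of \<open>T\<close> and has order
    \<open>m\<close> in the derivative, so \<open>T ^ m\<close> already exhausts its degree and
    \<open>K\<close> is constant.\<close>
  have "degree (pderiv P) = l * m"
    using sum_ramification[OF p P(2,3)] wM unfolding crit by (simp add: l_def m)
  moreover have "degree (pderiv P) = l * m + degree K"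
  proof -
    have "K \<noteq> 0" using dP P(3) by auto
    then show ?thesis unfolding dP using T0 by (simp add: degree_mult_eq degree_power_eq degT)
  qed
  ultimately have "degree K = 0" by simp
  then obtain \<kappa> where \<kappa>: "K = [:\<kappa>:]" by (auto elim: degree_eq_zeroE)
  define U where "U = pcompose T [:w, 1:]"
  have dU: "degree U = l" by (simp add: U_def degree_pcompose degT)
  have lcU: "coeff U l = 1" using lead_coeff_comp[of "[:w, 1:]" T] lcT dU by (simp add: U_def)
  have pU: "pcompose (pderiv T) [:w, 1:] = pderiv U"
    by (simp add: U_def pderiv_pcompose pderiv_pCons)
  have w0: "pcompose [:- w, 1:] [:w, 1:] = [:0, 1:]" by (simp add: pcompose_pCons)
  have "pcompose K [:w, 1:] = [:\<kappa>:]" by (simp add: \<kappa>)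
  then have UK: "U + smult (of_nat M) ([:0, 1:] * pderiv U) = [:\<kappa>:]"
    unfolding K_def by (simp only: pcompose_add pcompose_smult pcompose_mult pU w0 U_def[symmetric])
  have mid: "coeff U i = 0" if il: "0 < i" "i < l" for i
  proof -
    obtain j where j: "i = Suc j" using il by (cases i) auto
    have "coeff (U + smult (of_nat M) ([:0, 1:] * pderiv U)) i = 0"
      unfolding UK j by simp
    then have "of_nat (1 + M * i) * coeff U i = 0"
      by (simp add: j coeff_pderiv algebra_simps)
    \<comment> \<open>For 0 < i < l the factor lies strictly between 0 and 1 + M * l = p. At i = l
      it is zero in the field, which is how the leading coefficient survives.\<close>
    moreover have "of_nat (1 + M * i) \<noteq> (0::'a)"
    proof (rule of_nat_neq_0_less_CHAR)
      show "1 + M * i < CHAR('a)" using pl p(2) il M by (simp add: mult.commute)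
    qed simp
    ultimately show ?thesis by (metis mult_eq_0_iff)
  qed
  have l0: "l > 0" using pl p0 by (cases l) auto
  define a where "a = - coeff U 0"
  have xl: "[:0, 1:] ^ l = (monom 1 l :: 'a poly)" by (simp add: monom_altdef)
  have Ua: "U = [:0, 1:] ^ l - [:a:]"
  proof (rule poly_eqI)
    fix i
    have "coeff U i = (if i = l then 1 else if i = 0 then - a else 0)"
      using mid[of i] lcU l0 coeff_eq_0[of U i] dU by (cases i l rule: linorder_cases) (auto simp: a_def)
    then show "coeff U i = coeff ([:0, 1:] ^ l - [:a:]) i"
      using l0 by (auto simp: xl coeff_pCons split: nat.split)
  qed
  have "poly U 0 = poly T w" by (simp add: U_def poly_pcompose)
  moreover have "poly T w \<noteq> 0" using finS' by (auto simp: T_def poly_prod prod_zero_iff S'_def)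
  ultimately have "a \<noteq> 0" by (simp add: a_def poly_0_coeff_0)
  moreover have "shift_poly w P = [:0, 1:] * U ^ M"
    by (simp only: shift_poly_eq' PT pcompose_mult pcompose_linear_power w0 U_def)
  moreover have "M * l = p - 1" using pl by simp
  ultimately show ?thesis unfolding Ua by blast
qed

text \<open>The critical fibre of \<open>g\<close> has two points, which determines \<open>g\<close>
  up to the shift. Each of the two corresponding fibres of \<open>h\<close> has a single multiple
  point, so the cofactors have simple roots. The multiplicities of \<open>h\<close> are repeated in
  the conclusion because the descent identifies \<open>w\<close> and \<open>v\<close> by
  them.\<close>

theorem shift_poly_type_ii:
  fixes g h :: "'a::alg_closed_field poly"
  assumes p: "prime p" "CHAR('a) = p" and g: "lead_coeff g = 1" "degree g = p"
    and h: "lead_coeff h = 1" "degree h = p"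
    and t: "type_ii p g h w r"
  shows "\<exists>v q q'. poly h v \<noteq> poly h w \<and>
     shift_poly (poly h w) g = [:0, 1:] ^ r * ([:0, 1:] - [:poly h v - poly h w:]) ^ (p - r) \<and>
     shift_poly w h = [:0, 1:] ^ (p - r) * q \<and> (\<forall>a. order a q \<le> 1) \<and>
     shift_poly w h - [:poly h v - poly h w:] = ([:0, 1:] - [:v - w:]) ^ r * q' \<and> (\<forall>a. order a q' \<le> 1) \<and>
     q \<noteq> 0 \<and> q' \<noteq> 0 \<and> v \<noteq> w \<and> root_mult h w = p - r \<and> root_mult h v = r \<and>
     (\<forall>a. poly h a = poly h w \<longrightarrow> a \<noteq> w \<longrightarrow> root_mult h a = 1) \<and>
     (\<forall>a. poly h a = poly h v \<longrightarrow> a \<noteq> v \<longrightarrow> root_mult h a = 1)"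
proof -
  have p0: "p > 1" using p prime_gt_1_nat by auto
  obtain v where v: "poly h v \<noteq> poly h w" "root_mult g (poly h v) = p - r"
      "{b. poly g b = poly g (poly h w)} = {poly h w, poly h v}" "root_mult h v = r"
      "\<And>a. poly h a = poly h v \<Longrightarrow> a \<noteq> v \<Longrightarrow> root_mult h a = 1"
    and w: "root_mult g (poly h w) = r" "root_mult h w = p - r"
      "\<And>a. poly h a = poly h w \<Longrightarrow> a \<noteq> w \<Longrightarrow> root_mult h a = 1"
    using t unfolding type_ii_def by blast
  have lin: "pcompose [:- x, 1:] [:y, 1:] = [:- (x - y), 1:]" for x y :: 'a
    by (simp add: pcompose_pCons)
  have "g - [:poly g (poly h w):] = [:- poly h w, 1:] ^ r * [:- poly h v, 1:] ^ (p - r)"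
    using prod_root_mult[of g "poly g (poly h w)"] g p0 v w by simp
  then have sg: "shift_poly (poly h w) g = [:0, 1:] ^ r * ([:0, 1:] - [:poly h v - poly h w:]) ^ (p - r)"
    unfolding shift_poly_eq' by (simp add: pcompose_mult pcompose_linear_power lin)
  have fac: "\<exists>Q. h - [:poly h x:] = [:- x, 1:] ^ root_mult h x * Q \<and> Q \<noteq> 0 \<and> (\<forall>a. order a Q \<le> 1)"
    if o: "\<And>a. poly h a = poly h x \<Longrightarrow> a \<noteq> x \<Longrightarrow> root_mult h a = 1" for x
  proof -
    have nz: "h - [:poly h x:] \<noteq> 0" using minus_const_neq_0[of h] h p0 by simp
    obtain Q where Q: "h - [:poly h x:] = [:- x, 1:] ^ root_mult h x * Q" "\<not> [:- x, 1:] dvd Q"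
      using order_decomp[OF nz, of x] unfolding root_mult_def by blast
    have Q0: "Q \<noteq> 0" using Q nz by auto
    have "order a Q \<le> 1" for a
    proof (cases "a = x")
      case True
      then show ?thesis using Q(2) by (simp add: order_0I poly_eq_0_iff_dvd)
    next
      case False
      have le: "order a Q \<le> order a (h - [:poly h x:])"
        using dvd_imp_order_le[OF nz, of Q a] Q(1) by simp
      show ?thesis
      proof (cases "poly h a = poly h x")
        case True
        then show ?thesis using o[OF True False] le by (simp add: root_mult_def)
      next
        case False
        then have "order a (h - [:poly h x:]) = 0" by (intro order_0I) simp
        then show ?thesis using le by simp
      qed
    qed
    then show ?thesis using Q Q0 by blast
  qed
  have ord: "order a (pcompose Q [:w, 1:]) \<le> 1" if "\<forall>a. order a Q \<le> 1" "Q \<noteq> 0" for a Q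
  proof -
    have "order a ([:w, 1:] - [:poly [:w, 1:] a:]) = 1"
      using order_linear_self[of a] by simp
    then show ?thesis using order_pcompose[OF that(2), of "[:w, 1:]" a] that(1) by simp
  qed
  have nzc: "pcompose Q [:w, 1:] \<noteq> 0" if "Q \<noteq> 0" for Q :: "'a poly"
    using that by (simp add: pcompose_eq_0_iff)
  obtain Q where Q: "h - [:poly h w:] = [:- w, 1:] ^ (p - r) * Q" "Q \<noteq> 0" "\<forall>a. order a Q \<le> 1"
    using fac[of w] w by auto
  obtain Q' where Q': "h - [:poly h v:] = [:- v, 1:] ^ r * Q'" "Q' \<noteq> 0" "\<forall>a. order a Q' \<le> 1"
    using fac[of v] v by auto
  have "shift_poly w h = [:0, 1:] ^ (p - r) * pcompose Q [:w, 1:]"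
    unfolding shift_poly_eq' Q(1) by (simp add: pcompose_mult pcompose_linear_power lin)
  moreover have "shift_poly w h - [:poly h v - poly h w:] = pcompose (h - [:poly h v:]) [:w, 1:]"
    by (simp add: shift_poly_eq pcompose_diff)
  then have "shift_poly w h - [:poly h v - poly h w:] = ([:0, 1:] - [:v - w:]) ^ r * pcompose Q' [:w, 1:]"
    unfolding Q'(1) by (simp add: pcompose_mult pcompose_linear_power lin)
  moreover have "v \<noteq> w" using v(1) by auto
  ultimately show ?thesis
    using sg v w ord[OF Q(3,2)] ord[OF Q'(3,2)] nzc[OF Q(2)] nzc[OF Q'(2)] by blast
qed

section \<open>Descent to the base field\<close>

abbreviation ac :: "'a::field poly \<Rightarrow> 'a alg_closure poly" where
  "ac \<equiv> map_poly to_ac"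

lemma coeff_ac: "coeff (ac P) i = to_ac (coeff P i)"
  by (simp add: coeff_map_poly)

lemma degree_ac [simp]: "degree (ac P) = degree P"
  by (rule degree_map_poly) simp

lemma ac_eq_iff [simp]: "ac P = ac Q \<longleftrightarrow> P = Q"
  by (auto simp: poly_eq_iff coeff_ac)

lemma ac_eq_0_iff [simp]: "ac P = 0 \<longleftrightarrow> P = 0"
  using ac_eq_iff[of P 0] by simp

lemma ac_add: "ac (P + Q) = ac P + ac Q"
  and ac_diff: "ac (P - Q) = ac P - ac Q"
  and ac_smult: "ac (smult c P) = smult (to_ac c) (ac P)"
  and ac_pderiv: "ac (pderiv P) = pderiv (ac P)"
  and ac_mult: "ac (P * Q) = ac P * ac Q"
  by (auto simp: poly_eq_iff coeff_ac coeff_pderiv coeff_mult to_ac_sum)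

lemma ac_pCons: "ac (pCons c P) = pCons (to_ac c) (ac P)"
  by (simp add: map_poly_pCons)

lemma ac_power: "ac (P ^ n) = ac P ^ n"
  by (induction n) (simp_all add: ac_mult)

lemma poly_dvd_zero: "P dvd Q \<Longrightarrow> poly P a = 0 \<Longrightarrow> poly Q a = 0"
  by (auto simp: dvd_def)

lemma ac_dvd: "P dvd Q \<Longrightarrow> ac P dvd ac Q"
  by (auto simp: dvd_def ac_mult)

lemma ac_pcompose: "ac (pcompose P Q) = pcompose (ac P) (ac Q)"
  by (induction P) (simp_all add: pcompose_pCons ac_add ac_mult ac_pCons)

lemma poly_ac: "poly (ac P) (to_ac x) = to_ac (poly P x)"
  by (induction P) (simp_all add: ac_pCons)

lemma ac_shift_poly: "ac (shift_poly w P) = shift_poly (to_ac w) (ac P)"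
  by (simp add: shift_poly_eq ac_diff ac_pcompose ac_pCons poly_ac)

section \<open>Rationality of centres and of multiple roots\<close>

lemma coeff_shift_subleading:
  fixes Z :: "'a::comm_ring_1 poly"
  assumes "degree Z \<le> Suc n"
  shows "coeff (pcompose Z [:w, 1:]) n = coeff Z n + of_nat (Suc n) * w * coeff Z (Suc n)"
proof -
  have cf: "coeff ([:w, 1:] ^ i) n = of_nat (i choose n) * w ^ (i - n)" for i
  proof (cases "n \<le> i")
    case False
    then have "degree ([:w, 1:] ^ i) < n" using degree_power_le[of "[:w, 1:]" i] by simp
    then show ?thesis using False by (simp add: coeff_eq_0 binomial_eq_0)
  qed (simp add: coeff_linear_poly_power)
  have "coeff (pcompose Z [:w, 1:]) n = (\<Sum>i\<le>degree Z. coeff Z i * (of_nat (i choose n) * w ^ (i - n)))"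
    by (simp add: pcompose_eq_sum coeff_sum cf)
  also have "\<dots> = (\<Sum>i\<in>{n, Suc n}. coeff Z i * (of_nat (i choose n) * w ^ (i - n)))"
    by (rule sum.mono_neutral_cong) (use assms in \<open>auto simp: coeff_eq_0 binomial_eq_0\<close>)
  also have "\<dots> = coeff Z n + of_nat (Suc n) * w * coeff Z (Suc n)"
    by (simp add: algebra_simps)
  finally show ?thesis .
qed

text \<open>The second coefficient after the shift is linear in \<open>w\<close>, with slope
  \<open>degree Z\<close> times the leading coefficient. The slope is nonzero, so \<open>w\<close>
  solves a linear equation over the base field.\<close>

lemma shift_in_base_field:
  fixes Z :: "'a::field poly"
  assumes N: "of_nat (degree Z) \<noteq> (0::'a)"
    and c: "coeff (pcompose (ac Z) [:w, 1:]) (degree Z - 1) \<in> range to_ac"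
  shows "w \<in> range to_ac"
proof -
  obtain n where n: "degree Z = Suc n" using N by (cases "degree Z") auto
  obtain y where y: "coeff (pcompose (ac Z) [:w, 1:]) n = to_ac y" using c n by auto
  define k where "k = of_nat (Suc n) * coeff Z (Suc n)"
  have k0: "k \<noteq> 0" using N n by (metis k_def leading_coeff_0_iff degree_0 mult_eq_0_iff nat.distinct(1))
  have "to_ac y = to_ac (coeff Z n) + of_nat (Suc n) * w * to_ac (coeff Z (Suc n))"
    using coeff_shift_subleading[of "ac Z" n w] y n by (simp add: coeff_ac)
  also have "of_nat (Suc n) * w * to_ac (coeff Z (Suc n)) = to_ac k * w"
    by (simp add: k_def algebra_simps)
  finally have "w = to_ac ((y - coeff Z n) / k)" using k0 by (simp add: field_simps)
  then show ?thesis by blast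
qed

text \<open>Euclid's algorithm. The linear identity survives the passage to the closure, so
  \<open>D\<close> is still a greatest common divisor there.\<close>

lemma poly_bezout:
  fixes A B :: "'a::field poly"
  shows "\<exists>D u v. D = u * A + v * B \<and> D dvd A \<and> D dvd B"
proof (induction "euclidean_size B" arbitrary: A B rule: less_induct)
  case less
  show ?case
  proof (cases "B = 0")
    case True
    then show ?thesis by (intro exI[of _ A] exI[of _ 1] exI[of _ 0]) simp
  next
    case False
    then have "euclidean_size (A mod B) < euclidean_size B" by (rule mod_size_less)
    from less[OF this] obtain D u v where D: "D = u * B + v * (A mod B)" "D dvd B" "D dvd A mod B"
      by blast
    have "D dvd A" using D(2,3) by (metis dvd_mod_iff)
    moreover have "D = v * A + (u - v * (A div B)) * B"
    proof -
      have "v * A = v * (A div B * B) + v * (A mod B)"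
        by (simp only: distrib_left[symmetric] div_mult_mod_eq)
      then show ?thesis unfolding D(1) by (simp add: algebra_simps)
    qed
    ultimately show ?thesis using D(2) by blast
  qed
qed

text \<open>The greatest common divisor of \<open>P - \<beta>\<close> and \<open>P'\<close> is computed over the base field, and it
  is a power of \<open>x - v\<close> with exponent prime to the characteristic.\<close>

lemma multiple_root_in_base_field:
  fixes P :: "'a::field poly"
  assumes p: "prime p" "CHAR('a) = p" and P: "degree P = p" "pderiv P \<noteq> 0"
    and v: "poly (ac P) v = to_ac \<beta>" "1 < root_mult (ac P) v"
    and other: "\<And>a. poly (ac P) a = to_ac \<beta> \<Longrightarrow> a \<noteq> v \<Longrightarrow> root_mult (ac P) a = 1"
  shows "v \<in> range to_ac"
proof -
  define n where "n = root_mult (ac P) v - 1"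
  have pac: "prime p" "CHAR('a alg_closure) = p" "degree (ac P) = p" "pderiv (ac P) \<noteq> 0"
    using p P by (auto simp flip: ac_pderiv)
  obtain D s t where D: "D = s * (P - [:\<beta>:]) + t * pderiv P" "D dvd P - [:\<beta>:]" "D dvd pderiv P"
    using poly_bezout by blast
  have D0: "D \<noteq> 0" using D(3) P(2) by auto
  have dv: "ac D dvd ac P - [:to_ac \<beta>:]" "ac D dvd pderiv (ac P)"
    using ac_dvd[OF D(2)] ac_dvd[OF D(3)] by (simp_all add: ac_diff ac_pCons ac_pderiv)
  have roots: "a = v" if "poly (ac D) a = 0" for a
  proof -
    have "poly (ac P - [:to_ac \<beta>:]) a = 0" "poly (pderiv (ac P)) a = 0"
      using poly_dvd_zero[OF dv(1) that] poly_dvd_zero[OF dv(2) that] .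
    then have "poly (ac P) a = to_ac \<beta>" "1 < root_mult (ac P) a"
      using root_mult_gt_1_iff[OF pac] by auto
    then show ?thesis using other by force
  qed
  have ord: "order v (ac D) = n"
  proof (rule antisym)
    show "order v (ac D) \<le> n"
      using dvd_imp_order_le[OF pac(4) dv(2), of v] order_pderiv_root_mult[OF pac, of v] by (simp add: n_def)
    have "[:- v, 1:] ^ n dvd ac P - [:to_ac \<beta>:]"
      unfolding order_divides using v by (auto simp: root_mult_def n_def)
    moreover have "[:- v, 1:] ^ n dvd pderiv (ac P)"
      unfolding order_divides using order_pderiv_root_mult[OF pac, of v] by (simp add: n_def)
    moreover have "ac D = ac s * (ac P - [:to_ac \<beta>:]) + ac t * pderiv (ac P)"
      by (simp add: D(1) ac_add ac_mult ac_diff ac_pCons ac_pderiv)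
    ultimately have "[:- v, 1:] ^ n dvd ac D" by (metis dvd_add dvd_mult)
    then show "n \<le> order v (ac D)" using D0 by (simp add: order_divides)
  qed
  have n: "0 < n" "n < p" using v root_mult_less[OF pac, of v] by (auto simp: n_def)
  have "poly (ac D) v = 0" using order_root[of "ac D" v] ord n by simp
  then have Z: "{a. poly (ac D) a = 0} = {v}" using roots by blast
  define c where "c = lead_coeff (ac D)"
  have c0: "c \<noteq> 0" using D0 by (simp add: c_def coeff_ac)
  have E: "ac D = smult c ([:- v, 1:] ^ n)"
    using alg_closed_prod_roots[of "ac D"] D0 by (simp add: c_def Z ord)
  have "degree (ac D) = n"
    unfolding E using c0 by (simp add: degree_linear_power)
  then have dD: "degree D = n" by simp
  have "pcompose [:- v, 1:] [:v, 1:] = [:0, 1:]" by (simp add: pcompose_pCons)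
  then have "pcompose (ac D) [:v, 1:] = smult c (monom 1 n)"
    unfolding E by (simp only: pcompose_smult pcompose_linear_power monom_altdef smult_1_left)
  \<comment> \<open>Around \<open>v\<close> the polynomial is a monomial of degree n > 0, so its
    second coefficient is 0, an element of the base field.\<close>
  then have "coeff (pcompose (ac D) [:v, 1:]) (degree D - 1) = 0" using n dD by simp
  then have "coeff (pcompose (ac D) [:v, 1:]) (degree D - 1) \<in> range to_ac"
    by (metis rangeI to_ac_0)
  moreover have "of_nat (degree D) \<noteq> (0::'a)"
    using of_nat_neq_0_less_CHAR[where 'a='a, of n] n p dD by simp
  ultimately show ?thesis by (rule shift_in_base_field[rotated])
qed

text \<open>Division with remainder over the base field remains one over the closure; a nonzero
  remainder divisible by \<open>ac B\<close> would have too large a degree.\<close>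

lemma ac_cofactor:
  assumes eq: "ac A = ac B * C" and B: "B \<noteq> 0"
  shows "\<exists>C0. C = ac C0 \<and> A = B * C0"
proof -
  have "ac A = ac B * ac (A div B) + ac (A mod B)"
    by (simp flip: ac_mult ac_add)
  then have r: "ac (A mod B) = ac B * (C - ac (A div B))" using eq by (simp add: algebra_simps)
  have "C - ac (A div B) = 0"
  proof (rule ccontr)
    assume nz: "C - ac (A div B) \<noteq> 0"
    then have "degree (A mod B) = degree B + degree (C - ac (A div B))"
      using r B by (metis degree_ac degree_mult_eq ac_eq_0_iff)
    moreover have "A mod B \<noteq> 0" using r nz B by auto
    ultimately show False using degree_mod_less[OF B, of A] by simp
  qed
  then have C: "C = ac (A div B)" by simp
  then have "ac A = ac (B * (A div B))" using eq by (simp add: ac_mult)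
  then show ?thesis using C by auto
qed

lemma squarefree_if_simple_roots:
  assumes q: "q \<noteq> 0" and o: "\<And>a. order a (ac q) \<le> 1"
  shows "squarefree q"
  unfolding squarefree_def
proof (intro allI impI)
  fix z assume z: "z\<^sup>2 dvd q"
  then have z0: "z \<noteq> 0" using q by auto
  have "degree z = 0"
  proof (rule ccontr)
    assume "degree z \<noteq> 0"
    then obtain a where a: "poly (ac z) a = 0" using alg_closed_imp_poly_has_root[of "ac z"] by auto
    then have "order a (ac z) > 0" using z0 by (simp add: order_gt_0_iff)
    moreover have "order a (ac z ^ 2) \<le> order a (ac q)"
      by (rule dvd_imp_order_le) (use z q in \<open>auto simp: dvd_def ac_mult ac_power\<close>)
    ultimately show False using o[of a] z0 by (simp add: order_power)
  qed
  then show "z dvd 1" using z0 by (simp add: is_unit_iff_degree)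
qed

text \<open>In the field M * l = -1, so with B = x^l - a the product rule leaves B - x^l = -a times
  the power of B.\<close>

lemma pderiv_shape_i:
  fixes a :: "'a::field"
  assumes p: "prime p" "CHAR('a) = p" and Ml: "M * l = p - 1"
  shows "pderiv ([:0, 1:] * ([:0, 1:] ^ l - [:a:]) ^ M) = smult (- a) (([:0, 1:] ^ l - [:a:]) ^ (M - 1))"
proof -
  have "M * l \<noteq> 0" using Ml prime_gt_1_nat[OF p(1)] by simp
  then obtain m k where mk: "M = Suc m" "l = Suc k" by (cases M; cases l) auto
  define B where "B = [:0, 1:] ^ l - [:a:]"
  have "of_nat (M * l) + (1::'a) = of_nat (M * l + 1)" by simp
  also have "M * l + 1 = CHAR('a)" using Ml p prime_gt_1_nat[OF p(1)] by simp
  finally have m1: "of_nat M * of_nat l = (-1::'a)" by (simp add: eq_neg_iff_add_eq_0)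
  have BM: "B ^ M = B ^ m * B" by (simp add: mk)
  have dB: "pderiv B = smult (of_nat l) ([:0, 1:] ^ k)"
    unfolding B_def mk pderiv_diff pderiv_power_Suc by (simp add: pderiv_pCons)
  have "pderiv ([:0, 1:] * B ^ M) = [:0, 1:] * (smult (of_nat M) (B ^ m) * pderiv B) + B ^ M"
    unfolding mk pderiv_mult pderiv_power_Suc by (simp add: pderiv_pCons)
  also have "[:0, 1:] * (smult (of_nat M) (B ^ m) * pderiv B) = smult (of_nat M * of_nat l) (B ^ m * [:0, 1:] ^ l)"
    unfolding dB mk power_Suc by (simp only: mult_smult_left mult_smult_right smult_smult mult_ac)
  also have "\<dots> + B ^ M = B ^ m * (B - [:0, 1:] ^ l)"
    unfolding m1 BM by (simp add: right_diff_distrib del: mult_pCons_left mult_pCons_right)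
  also have "B - [:0, 1:] ^ l = [:- a:]" by (simp add: B_def)
  finally show ?thesis by (simp add: B_def mk)
qed

text \<open>In the field p - r = -r, so the two terms of the product rule combine through (x - a) -
  x = -a.\<close>

lemma pderiv_shape_ii:
  fixes a :: "'a::field"
  assumes p: "prime p" "CHAR('a) = p" and r: "0 < r" "r < p"
  shows "pderiv ([:0, 1:] ^ r * ([:0, 1:] - [:a:]) ^ (p - r)) =
    smult (- of_nat r * a) ([:0, 1:] ^ (r - 1) * [:- a, 1:] ^ (p - r - 1))"
proof -
  obtain m k where mk: "r = Suc m" "p - r = Suc k" using r by (cases r; cases "p - r") auto
  have "of_nat r + of_nat (p - r) = (of_nat p :: 'a)" using r by (simp flip: of_nat_add)
  then have pr: "of_nat (Suc k) = - (of_nat (Suc m) :: 'a)"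
    using mk p of_nat_CHAR[where 'a='a] by (metis add_eq_0_iff)
  define s t where "s = [:0, 1::'a:]" and "t = [:- a, 1:]"
  have st: "[:0, 1:] - [:a:] = t" by (simp add: t_def)
  have ds: "pderiv s = 1" "pderiv t = 1" by (auto simp: s_def t_def pderiv_pCons)
  have "pderiv (s ^ Suc m * t ^ Suc k) = smult (of_nat (Suc m)) (s ^ m * t ^ k * (t - s))"
    unfolding pderiv_mult pderiv_power_Suc ds pr unfolding power_Suc
    by (simp add: algebra_simps smult_diff_right del: of_nat_Suc)
  also have "t - s = [:- a:]" by (simp add: s_def t_def)
  finally have "pderiv (s ^ r * t ^ (p - r)) = smult (of_nat r) (s ^ m * t ^ k * [:- a:])"
    unfolding mk[symmetric] .
  moreover have "m = r - 1" "k = p - r - 1" using mk by auto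
  ultimately show ?thesis
    unfolding st unfolding s_def[symmetric] t_def[symmetric] by (simp add: mult.commute)
qed

lemma degree_shape_factor:
  assumes "l > 0"
  shows "degree ([:0, 1:] ^ l - [:a::'a::field:]) = l" "lead_coeff ([:0, 1:] ^ l - [:a:]) = 1"
proof -
  have e: "degree ([:0, 1:] ^ l :: 'a poly) = l" by (simp add: degree_linear_power[of 0, simplified])
  then show d: "degree ([:0, 1:] ^ l - [:a:]) = l"
    using assms by (metis add_uminus_conv_diff degree_add_eq_left degree_minus degree_pCons_0)
  have "[:0, 1:] ^ l = (monom 1 l :: 'a poly)" by (simp add: monom_altdef)
  then show "lead_coeff ([:0, 1:] ^ l - [:a:]) = 1"
    unfolding d using assms by (simp add: coeff_pCons split: nat.split)
qed

section \<open>Shifts of polynomials and of decompositions\<close>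

lemma shift_poly_degree: "degree (shift_poly w P) = degree P" for P :: "'a::field poly"
  by (simp add: shift_poly_def degree_pcompose)

lemma lead_coeff_shift: "lead_coeff (pcompose P [:w, 1:]) = lead_coeff P" for P :: "'a::field poly"
  by (subst lead_coeff_comp) simp_all

lemma pderiv_shift_poly: "pderiv (shift_poly w P) = pcompose (pderiv P) [:w, 1:]" for P :: "'a::field poly"
  by (simp add: shift_poly_eq pderiv_diff pderiv_pcompose pderiv_pCons)

lemma normal_shift_poly: "normal_poly (shift_poly w P)" if "lead_coeff P = 1" "degree P > 0" for P :: "'a::field poly"
proof -
  have "degree (pcompose P [:w, 1:]) = degree P" by (simp add: degree_pcompose)
  moreover have "coeff (shift_poly w P) (degree P) = coeff (pcompose P [:w, 1:]) (degree P)"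
    using that(2) by (simp add: shift_poly_eq coeff_pCons split: nat.split)
  ultimately have "lead_coeff (shift_poly w P) = lead_coeff (pcompose P [:w, 1:])"
    by (simp add: shift_poly_degree)
  moreover have "coeff (shift_poly w P) 0 = 0"
    by (simp add: shift_poly_eq poly_pcompose flip: poly_0_coeff_0)
  ultimately show ?thesis using that(1) lead_coeff_shift[of P w] unfolding normal_poly_def by metis
qed

lemma shift_poly_shift_poly:
  fixes P :: "'a::field poly"
  assumes "coeff P 0 = 0"
  shows "shift_poly w (shift_poly (- w) P) = P"
proof -
  have "pcompose (pcompose P [:- w, 1:]) [:w, 1:] = P"
    by (simp flip: pcompose_assoc add: pcompose_pCons)
  moreover have "poly P 0 = 0" using assms by (simp add: poly_0_coeff_0)
  ultimately show ?thesis by (simp add: shift_poly_eq pcompose_diff poly_pcompose)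
qed

lemma shift_poly_pcompose:
  fixes g h :: "'a::field poly"
  shows "pcompose (shift_poly (poly h w) g) (shift_poly w h) = shift_poly w (pcompose g h)"
proof -
  have "pcompose [:poly h w, 1:] (shift_poly w h) = pcompose h [:w, 1:]"
    by (simp add: shift_poly_eq pcompose_pCons)
  then show ?thesis
    by (simp add: shift_poly_eq[of "poly h w"] shift_poly_eq[of _ "pcompose g h"] pcompose_diff poly_pcompose
        flip: pcompose_assoc)
qed

lemma normal_decomposition_shift:
  fixes f g h :: "'a::field poly"
  assumes "normal_decomposition f (g, h)"
  shows "normal_decomposition (shift_poly w f) (shift_poly (poly h w) g, shift_poly w h)"
  using assms normal_shift_poly[of g] normal_shift_poly[of h]
  by (auto simp: normal_decomposition_def decomposition_def shift_poly_degree shift_poly_pcompose normal_poly_def)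

text \<open>The shift by \<open>-w\<close> undoes the shift by \<open>w\<close>. This carries
  results about the decompositions of \<open>f\<close> over to those of the shifted polynomial,
  which the theorem speaks of.\<close>

lemma normal_decomposition_unshift:
  fixes f g1 h1 :: "'a::field poly"
  assumes f: "normal_poly f" and d: "normal_decomposition (shift_poly w f) (g1, h1)"
  shows "\<exists>g h. normal_decomposition f (g, h) \<and> g1 = shift_poly (poly h w) g \<and> h1 = shift_poly w h"
proof -
  define h where "h = shift_poly (- w) h1"
  define g where "g = shift_poly (poly h1 (- w)) g1"
  have c: "coeff g1 0 = 0" "coeff h1 0 = 0" "coeff f 0 = 0"
    using d f by (auto simp: normal_decomposition_def normal_poly_def)
  have "normal_decomposition f (g, h)"
    using normal_decomposition_shift[OF d, of "- w"] shift_poly_shift_poly[OF c(3), of "- w"]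
    by (simp add: g_def h_def)
  moreover have "shift_poly w h = h1" using shift_poly_shift_poly[OF c(2)] by (simp add: h_def)
  moreover have "poly h w = - poly h1 (- w)"
    using c(2) by (simp add: h_def shift_poly_eq poly_pcompose poly_0_coeff_0)
  then have "shift_poly (poly h w) g = g1"
    using shift_poly_shift_poly[OF c(1), of "- poly h1 (- w)"] by (simp add: g_def)
  ultimately show ?thesis by metis
qed

section \<open>Parameters and centres of the two shapes in the base field\<close>

lemma coeff_pcompose_monom_eq_0:
  fixes P :: "'a::comm_ring_1 poly"
  assumes "\<not> l dvd j"
  shows "coeff (pcompose P (monom 1 l)) j = 0"
  unfolding pcompose_eq_sum coeff_sum
proof (rule sum.neutral, rule ballI)
  fix i
  have "l * i \<noteq> j" using assms by auto
  then show "coeff (smult (coeff P i) (monom 1 l ^ i)) j = 0" by (simp add: monom_power)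
qed

lemma lead_coeff_smult_power:
  "lead_coeff (smult c (B ^ n)) = c" if "lead_coeff B = 1" for B :: "'a::field poly"
  using that by (simp add: lead_coeff_power)

text \<open>The parameter is visible in the base field: \<open>-a\<close> is the leading coefficient
  of the derivative.\<close>

lemma shape_i_descent:
  fixes P :: "'a::field poly"
  assumes p: "prime p" "CHAR('a) = p" and Ml: "M * l = p - 1"
    and a: "a \<noteq> 0" and eq: "ac P = [:0, 1:] * ([:0, 1:] ^ l - [:a:]) ^ M"
  shows "\<exists>a0. a0 \<noteq> 0 \<and> P = [:0, 1:] * ([:0, 1:] ^ l - [:a0:]) ^ M"
proof -
  have pK: "prime p" "CHAR('a alg_closure) = p" using p by auto
  have "M * l \<noteq> 0" using Ml prime_gt_1_nat[OF p(1)] by simp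
  then have l0: "l > 0" by simp
  have "to_ac (lead_coeff (pderiv P)) = lead_coeff (pderiv (ac P))"
    by (simp flip: ac_pderiv add: coeff_ac)
  also have "\<dots> = - a"
    unfolding eq pderiv_shape_i[OF pK Ml] using degree_shape_factor(2)[OF l0]
    by (rule lead_coeff_smult_power)
  finally obtain a0 where a0: "a = to_ac a0" by (metis minus_minus to_ac_minus)
  have "ac P = ac ([:0, 1:] * ([:0, 1:] ^ l - [:a0:]) ^ M)"
    unfolding eq by (simp add: a0 ac_mult ac_power ac_diff ac_pCons del: mult_pCons_left)
  then show ?thesis using a a0 by auto
qed

text \<open>The derivative of \<open>h\<close> has degree (M - 1) * l, strictly between 0 and p. For
  l > 1 it is a polynomial in (x - w)^l, so around \<open>w\<close> its second coefficient vanishes.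
  For l = 1 it is a multiple of a power of x - w - a, which makes w + a rational, and a is rational
  by the leading coefficient.\<close>

lemma shape_i_centre:
  fixes h :: "'a::field poly"
  assumes p: "prime p" "CHAR('a) = p" and Ml: "M * l = p - 1" "1 < M"
    and a: "a \<noteq> 0" and eq: "shift_poly w (ac h) = [:0, 1:] * ([:0, 1:] ^ l - [:a:]) ^ M"
  shows "w \<in> range to_ac"
proof -
  have pK: "prime p" "CHAR('a alg_closure) = p" using p by auto
  have "M * l \<noteq> 0" using Ml prime_gt_1_nat[OF p(1)] by simp
  then have l0: "l > 0" by simp
  define Z where "Z = pderiv h"
  define n where "n = M - 1"
  have n: "n > 0" using Ml by (simp add: n_def)
  let ?B = "[:0, 1:] ^ l - [:a:]"
  have Z: "pcompose (ac Z) [:w, 1:] = smult (- a) (?B ^ n)"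
    unfolding Z_def n_def ac_pderiv pderiv_shift_poly[symmetric] eq by (rule pderiv_shape_i[OF pK Ml(1)])
  have B0: "?B \<noteq> 0" using degree_shape_factor(1)[OF l0, of a] l0 by auto
  have "degree Z = degree (pcompose (ac Z) [:w, 1:])" by (simp add: degree_pcompose)
  also have "\<dots> = n * l" unfolding Z using a B0 degree_shape_factor(1)[OF l0, of a] by (simp add: degree_power_eq)
  finally have dZ: "degree Z = n * l" .
  have "n * l < M * l" using l0 Ml(2) by (intro mult_less_mono1) (simp_all add: n_def)
  then have "n * l < p" using Ml(1) by linarith
  then have N0: "of_nat (degree Z) \<noteq> (0::'a)"
    using of_nat_neq_0_less_CHAR[where 'a='a, of "degree Z"] dZ n l0 p(2) by simp
  show ?thesis
  proof (cases "l = 1")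
    case False
    have "?B = pcompose [:- a, 1:] (monom 1 l)" by (simp add: pcompose_pCons monom_altdef)
    then have "?B ^ n = pcompose ([:- a, 1:] ^ n) (monom 1 l)" by (simp only: pcompose_linear_power)
    moreover have "\<not> l dvd n * l - 1"
    proof
      assume dv: "l dvd n * l - 1"
      have "l dvd n * l - (n * l - 1)" by (rule dvd_diff_nat[OF _ dv]) simp
      moreover have "n * l - (n * l - 1) = 1" using n l0 by simp
      ultimately show False using False by simp
    qed
    ultimately have "coeff (?B ^ n) (degree Z - 1) = 0"
      unfolding dZ using coeff_pcompose_monom_eq_0 by metis
    then have "coeff (pcompose (ac Z) [:w, 1:]) (degree Z - 1) = to_ac 0" unfolding Z by simp
    then show ?thesis by (rule shift_in_base_field[OF N0 range_eqI])
  next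
    case True
    have "to_ac (lead_coeff Z) = - a"
      using lead_coeff_shift[of "ac Z" w] lead_coeff_smult_power[OF degree_shape_factor(2)[OF l0, of a], of "- a" n]
      unfolding Z by (simp add: coeff_ac)
    then obtain a0 where a0: "a = to_ac a0" by (metis minus_minus to_ac_minus)
    have "pcompose (ac Z) [:w + a, 1:] = pcompose (pcompose (ac Z) [:w, 1:]) [:a, 1:]"
      by (simp flip: pcompose_assoc add: pcompose_pCons)
    also have "\<dots> = smult (- a) (pcompose ?B [:a, 1:] ^ n)"
      unfolding Z pcompose_smult pcompose_linear_power ..
    also have "pcompose ?B [:a, 1:] = [:0, 1:]" using True by (simp add: pcompose_pCons pcompose_diff)
    also have "[:0, 1:] ^ n = (monom 1 n :: 'a alg_closure poly)" by (simp add: monom_altdef)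
    finally have "coeff (pcompose (ac Z) [:w + a, 1:]) (degree Z - 1) = to_ac 0"
      using n dZ True by simp
    then have "w + a \<in> range to_ac" by (rule shift_in_base_field[OF N0 range_eqI])
    then obtain y where "w + a = to_ac y" by blast
    then have "w = to_ac (y - a0)" using a0 by (simp add: algebra_simps)
    then show ?thesis by blast
  qed
qed

text \<open>The order of descent matters. The leading coefficient of g' yields the parameter of
  \<open>g\<close>; then its second coefficient yields the value of \<open>h\<close> at
  \<open>w\<close>, since the degree p - 2 is nonzero in the field. Now both critical values of
  \<open>h\<close> are rational, so \<open>w\<close> and \<open>v\<close> are rational as the only
  multiple points over them, and the cofactors follow by division.\<close>

lemma type_ii_descent:
  fixes g h :: "'a::field poly"
  assumes p: "prime p" "CHAR('a) = p" and g: "lead_coeff g = 1" "degree g = p"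
    and h: "lead_coeff h = 1" "degree h = p" "pderiv h \<noteq> 0"
    and t: "type_ii p (ac g) (ac h) w r"
  shows "\<exists>w0. w = to_ac w0 \<and> (\<exists>a b. a \<noteq> 0 \<and> b \<noteq> 0 \<and>
     shift_poly (poly h w0) g = [:0, 1:] ^ r * ([:0, 1:] - [:a:]) ^ (p - r) \<and>
     (\<exists>q q'. squarefree q \<and> degree q = r \<and> squarefree q' \<and> degree q' = p - r \<and>
        shift_poly w0 h = [:0, 1:] ^ (p - r) * q \<and>
        shift_poly w0 h - [:a:] = ([:0, 1:] - [:b:]) ^ r * q'))"
proof -
  have pK: "prime p" "CHAR('a alg_closure) = p" using p by auto
  have monK: "lead_coeff (ac g) = 1" "degree (ac g) = p" "lead_coeff (ac h) = 1" "degree (ac h) = p"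
    using g h by (simp_all add: coeff_ac)
  have r: "1 < r" "r < p - 1" using t by (auto simp: type_ii_def)
  obtain v q q' where V: "poly (ac h) v \<noteq> poly (ac h) w"
     "shift_poly (poly (ac h) w) (ac g) = [:0, 1:] ^ r * ([:0, 1:] - [:poly (ac h) v - poly (ac h) w:]) ^ (p - r)"
     "shift_poly w (ac h) = [:0, 1:] ^ (p - r) * q" "\<forall>a. order a q \<le> 1"
     "shift_poly w (ac h) - [:poly (ac h) v - poly (ac h) w:] = ([:0, 1:] - [:v - w:]) ^ r * q'" "\<forall>a. order a q' \<le> 1"
     "q \<noteq> 0" "q' \<noteq> 0" "v \<noteq> w" "root_mult (ac h) w = p - r" "root_mult (ac h) v = r"
     "\<forall>a. poly (ac h) a = poly (ac h) w \<longrightarrow> a \<noteq> w \<longrightarrow> root_mult (ac h) a = 1"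
     "\<forall>a. poly (ac h) a = poly (ac h) v \<longrightarrow> a \<noteq> v \<longrightarrow> root_mult (ac h) a = 1"
    using shift_poly_type_ii[OF pK monK t] by (elim exE conjE) (rule that)
  define A where "A = poly (ac h) v - poly (ac h) w"
  define Z where "Z = pderiv g"
  have A0: "A \<noteq> 0" using V(1) by (simp add: A_def)
  have r0: "of_nat r \<noteq> (0 :: 'a alg_closure)" "of_nat r \<noteq> (0 :: 'a)"
    using of_nat_neq_0_less_CHAR[where 'a="'a alg_closure", of r] of_nat_neq_0_less_CHAR[where 'a='a, of r] r p pK by auto
  have Z: "pcompose (ac Z) [:poly (ac h) w, 1:] = smult (- of_nat r * A) ([:0, 1:] ^ (r - 1) * [:- A, 1:] ^ (p - r - 1))"
    unfolding Z_def ac_pderiv pderiv_shift_poly[symmetric] V(2) A_def[symmetric]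
    by (rule pderiv_shape_ii[OF pK]) (use r in auto)
  have mon: "lead_coeff ([:0, 1:] ^ (r - 1) * [:- A, 1:] ^ (p - r - 1)) = 1"
    by (simp only: lead_coeff_mult lead_coeff_power) simp
  have "degree ([:0, 1:] ^ (r - 1) * [:- A, 1:] ^ (p - r - 1)) = (r - 1) + (p - r - 1)"
    by (subst degree_mult_eq) (simp_all add: degree_linear_power[of 0, simplified] degree_linear_power)
  then have "degree (pcompose (ac Z) [:poly (ac h) w, 1:]) = (r - 1) + (p - r - 1)"
    unfolding Z using A0 r0 by simp
  then have dZ: "degree Z = p - 2" using r by (simp add: degree_pcompose)
  then have N0: "of_nat (degree Z) \<noteq> (0::'a)"
    using of_nat_neq_0_less_CHAR[where 'a='a, of "p - 2"] r p by simp
  have "to_ac (lead_coeff Z) = - of_nat r * A"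
    using lead_coeff_shift[of "ac Z" "poly (ac h) w"] unfolding Z lead_coeff_smult mon
    by (simp add: coeff_ac)
  then have "A = to_ac (- lead_coeff Z / of_nat r)" using r0 by (simp add: field_simps)
  then obtain A' where A': "A = to_ac A'" by blast
  have "pcompose (ac Z) [:poly (ac h) w, 1:] = ac (smult (- of_nat r * A') ([:0, 1:] ^ (r - 1) * [:- A', 1:] ^ (p - r - 1)))"
    unfolding Z A' ac_smult ac_mult ac_power ac_pCons by simp
  then have "coeff (pcompose (ac Z) [:poly (ac h) w, 1:]) (degree Z - 1) \<in> range to_ac"
    by (simp only: coeff_ac) (rule rangeI)
  then have "poly (ac h) w \<in> range to_ac" by (rule shift_in_base_field[OF N0])
  then obtain \<beta> where \<beta>: "poly (ac h) w = to_ac \<beta>" by blast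
  then have \<beta>': "poly (ac h) v = to_ac (\<beta> + A')" using A' by (simp add: A_def algebra_simps)
  have "w \<in> range to_ac"
    by (rule multiple_root_in_base_field[OF p h(2,3) \<beta>]) (use V(10,12) r \<beta> in auto)
  then obtain w0 where w0: "w = to_ac w0" by blast
  have "v \<in> range to_ac"
    by (rule multiple_root_in_base_field[OF p h(2,3) \<beta>']) (use V(11,13) r \<beta>' in auto)
  then obtain v0 where v0: "v = to_ac v0" by blast
  define a where "a = poly h v0 - poly h w0"
  define b where "b = v0 - w0"
  have a: "poly (ac h) v - poly (ac h) w = to_ac a" by (simp add: a_def v0 w0 poly_ac)
  have b: "v - w = to_ac b" by (simp add: b_def v0 w0)
  have nz: "a \<noteq> 0" "b \<noteq> 0" using V(1,9) by (auto simp: a_def b_def v0 w0 poly_ac)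
  have "ac (shift_poly (poly h w0) g) = ac ([:0, 1:] ^ r * ([:0, 1:] - [:a:]) ^ (p - r))"
    using V(2) unfolding a unfolding w0 poly_ac ac_shift_poly
    by (simp add: ac_mult ac_power ac_diff ac_pCons)
  then have sg: "shift_poly (poly h w0) g = [:0, 1:] ^ r * ([:0, 1:] - [:a:]) ^ (p - r)"
    by (simp only: ac_eq_iff)
  have "ac (shift_poly w0 h) = ac ([:0, 1:] ^ (p - r)) * q"
    using V(3) unfolding w0 ac_shift_poly by (simp add: ac_power ac_pCons)
  from ac_cofactor[OF this] obtain q0 where q0: "q = ac q0" "shift_poly w0 h = [:0, 1:] ^ (p - r) * q0"
    by auto
  have "ac (shift_poly w0 h - [:a:]) = ac (([:0, 1:] - [:b:]) ^ r) * q'"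
    using V(5) unfolding a b unfolding w0 ac_shift_poly[symmetric] by (simp add: ac_power ac_pCons ac_diff)
  from ac_cofactor[OF this] obtain q1 where q1: "q' = ac q1" "shift_poly w0 h - [:a:] = ([:0, 1:] - [:b:]) ^ r * q1"
    by auto
  have nzq: "q0 \<noteq> 0" "q1 \<noteq> 0" using V(7,8) q0 q1 by auto
  have sq: "squarefree q0" "squarefree q1"
    using squarefree_if_simple_roots[OF nzq(1)] squarefree_if_simple_roots[OF nzq(2)] V(4,6) q0(1) q1(1) by auto
  have "degree (shift_poly w0 h) = p" by (simp add: shift_poly_degree h)
  moreover have "degree ([:0, 1:] ^ (p - r) * q0) = (p - r) + degree q0"
    using nzq by (subst degree_mult_eq) (simp_all add: degree_linear_power[of 0, simplified])
  ultimately have dq0: "degree q0 = r" using q0(2) r by simp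
  have "degree (shift_poly w0 h - [:a:]) = p"
    using \<open>degree (shift_poly w0 h) = p\<close> r
    by (metis add_uminus_conv_diff degree_add_eq_left degree_minus degree_pCons_0 gr_implies_not0 neq0_conv not_less0 diff_0_eq_0)
  moreover have "degree (([:0, 1:] - [:b:]) ^ r * q1) = r + degree q1"
    using nzq by (subst degree_mult_eq) (simp_all add: degree_linear_power)
  ultimately have "degree q1 = p - r" using q1(2) by simp
  then show ?thesis using w0 nz sg q0(2) q1(2) sq dq0 by blast
qed

text \<open>The derivative has degree (M - 1) * l = p - 1 - l by the first shape and p - 2 by the
  second, so l = 1. Then its only possible root is w + a, but the second shape gives the two roots
  w' and w' + a'.\<close>

lemma shapes_exclusive:
  fixes g :: "'a::field poly"
  assumes p: "prime p" "CHAR('a) = p" and Ml: "M * l = p - 1" and r: "1 < r" "r < p - 1"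
    and a: "a \<noteq> 0" "a' \<noteq> 0"
    and s1: "shift_poly w g = [:0, 1:] * ([:0, 1:] ^ l - [:a:]) ^ M"
    and s2: "shift_poly w' g = [:0, 1:] ^ r * ([:0, 1:] - [:a':]) ^ (p - r)"
  shows False
proof -
  have "M * l \<noteq> 0" using Ml prime_gt_1_nat[OF p(1)] by simp
  then have l0: "l > 0" "M > 0" by simp_all
  define Z where "Z = pderiv g"
  let ?B = "[:0, 1:] ^ l - [:a:]"
  have Z1: "pcompose Z [:w, 1:] = smult (- a) (?B ^ (M - 1))"
    unfolding Z_def pderiv_shift_poly[symmetric] s1 by (rule pderiv_shape_i[OF p Ml])
  have Z2: "pcompose Z [:w', 1:] = smult (- of_nat r * a') ([:0, 1:] ^ (r - 1) * [:- a', 1:] ^ (p - r - 1))"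
    unfolding Z_def pderiv_shift_poly[symmetric] s2 by (rule pderiv_shape_ii[OF p]) (use r in auto)
  have r0: "of_nat r \<noteq> (0 :: 'a)"
    using of_nat_neq_0_less_CHAR[where 'a='a, of r] r p by auto
  have B0: "?B \<noteq> 0" using degree_shape_factor(1)[OF l0(1), of a] l0 by auto
  have "degree Z = degree (pcompose Z [:w, 1:])" by (simp add: degree_pcompose)
  also have "\<dots> = (M - 1) * l" unfolding Z1 using a B0 degree_shape_factor(1)[OF l0(1), of a] by (simp add: degree_power_eq)
  finally have d1: "degree Z = (M - 1) * l" .
  have "degree Z = degree (pcompose Z [:w', 1:])" by (simp add: degree_pcompose)
  also have "\<dots> = degree ([:0, 1:] ^ (r - 1) * [:- a', 1:] ^ (p - r - 1))"
    unfolding Z2 using a r0 by simp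
  also have "\<dots> = (r - 1) + (p - r - 1)"
    by (subst degree_mult_eq) (simp_all add: degree_linear_power[of 0, simplified] degree_linear_power)
  finally have "(M - 1) * l = p - 2" using d1 r by simp
  moreover have "(M - 1) * l + l = M * l" using l0 by (cases M) auto
  ultimately have l1: "l = 1" using Ml r by simp
  have roots: "y = w + a" if "poly Z y = 0" for y
  proof -
    have "poly (pcompose Z [:w, 1:]) (y - w) = 0" using that by (simp add: poly_pcompose)
    then have "poly (?B ^ (M - 1)) (y - w) = 0" unfolding Z1 using a by simp
    then show ?thesis using l1 by (simp add: algebra_simps)
  qed
  have "poly (pcompose Z [:w', 1:]) 0 = 0" "poly (pcompose Z [:w', 1:]) a' = 0"
    unfolding Z2 using r by auto
  then have "poly Z w' = 0" "poly Z (w' + a') = 0" by (simp_all add: poly_pcompose)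
  then show False using roots a by (metis add_cancel_right_right)
qed

lemma additive_shape:
  fixes P :: "'a::field poly"
  assumes p: "prime p" "CHAR('a) = p" and P: "lead_coeff P = 1" "degree P = p" "coeff P 0 = 0"
    and d: "pderiv P \<noteq> 0" "degree (pderiv P) = 0"
  shows "\<exists>a. a \<noteq> 0 \<and> P = [:0, 1:] * ([:0, 1:] ^ (p - 1) - [:a:])"
proof -
  have p0: "p > 1" using p prime_gt_1_nat by auto
  define G where "G = P - monom 1 p"
  have G: "degree G = 1" using monic_minus_monom(1)[OF p P(1,2) d(1)] d(2) by (simp add: G_def)
  have "coeff G 0 = 0" using P p0 by (simp add: G_def)
  then have Ge: "G = [:0, coeff G 1:]"
    using G by (auto simp: poly_eq_iff coeff_pCons coeff_eq_0 split: nat.split)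
  have "coeff G 1 \<noteq> 0" using G by (metis One_nat_def leading_coeff_0_iff degree_0 zero_neq_one)
  obtain k where k: "p = Suc k" using p0 by (cases p) auto
  have "P = monom 1 p + G" by (simp add: G_def)
  also have "monom 1 p = [:0, 1:] * ([:0, 1:] ^ (p - 1) :: 'a poly)" by (simp add: monom_altdef k del: mult_pCons_left)
  also have "G = [:0, 1:] * [:coeff G 1:]" by (subst Ge) simp
  finally have "P = [:0, 1:] * ([:0, 1:] ^ (p - 1) + [:coeff G 1:])"
    by (simp only: distrib_left)
  also have "[:0, 1:] ^ (p - 1) + [:coeff G 1:] = [:0, 1:] ^ (p - 1) - [:- coeff G 1:]" by simp
  finally have "P = [:0, 1:] * ([:0, 1:] ^ (p - 1) - [:- coeff G 1:])" .
  then show ?thesis using \<open>coeff G 1 \<noteq> 0\<close> by (intro exI[of _ "- coeff G 1"]) simp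
qed

section \<open>All normal decompositions of one polynomial\<close>

locale normal_collision =
  fixes p :: nat and f :: "'a::field poly"
  assumes prime: "prime p" and CHAR: "CHAR('a) = p"
    and normal: "normal_poly f" and deg: "degree f = p ^ 2" and deriv: "pderiv f \<noteq> 0"
    and ex_two: "\<exists>d e. normal_decomposition f d \<and> normal_decomposition f e \<and> d \<noteq> e"
begin

lemma decomposition_facts:
  assumes "normal_decomposition f (g, h)"
  shows "lead_coeff g = 1" "degree g = p" "coeff g 0 = 0" "lead_coeff h = 1" "degree h = p" "coeff h 0 = 0"
    "f = pcompose g h" "pderiv g \<noteq> 0" "pderiv h \<noteq> 0"
proof -
  show m: "lead_coeff g = 1" "coeff g 0 = 0" "lead_coeff h = 1" "coeff h 0 = 0" "f = pcompose g h"
    using assms by (auto simp: normal_decomposition_def decomposition_def normal_poly_def)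
  have ge: "degree g \<ge> 2" "degree h \<ge> 2"
    using assms by (auto simp: normal_decomposition_def decomposition_def)
  have pr: "degree g * degree h = p ^ 2" using deg m(5) by (simp add: degree_pcompose)
  then have "degree g dvd p ^ 2" by (metis dvd_triv_left)
  then obtain i where i: "i \<le> 2" "degree g = p ^ i" using divides_primepow_nat[OF prime] by blast
  have p0: "p > 0" using prime prime_gt_0_nat by simp
  have "i \<noteq> 0"
  proof
    assume "i = 0"
    then show False using i(2) ge(1) by simp
  qed
  moreover have "i \<noteq> 2" using pr i ge(2) p0 by auto
  ultimately have "i = 1" using i(1) by linarith
  then show dg: "degree g = p" using i by simp
  then show "degree h = p" using pr p0 by (simp add: power2_eq_square)
  show "pderiv g \<noteq> 0" "pderiv h \<noteq> 0" using deriv m(5) by (auto simp: pderiv_pcompose)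
qed

lemma other_decomposition:
  "\<exists>gs hs. normal_decomposition f (gs, hs) \<and> (gs, hs) \<noteq> (g, h)"
  using ex_two by (metis prod.exhaust)

lemma inner_neq:
  assumes d: "normal_decomposition f (g, h)" "normal_decomposition f (gs, hs)" "(gs, hs) \<noteq> (g, h)"
  shows "h \<noteq> hs"
proof
  assume eq: "h = hs"
  have "pcompose (g - gs) h = 0"
    using decomposition_facts(7)[OF d(1)] decomposition_facts(7)[OF d(2)] eq by (simp add: pcompose_diff)
  moreover have "degree h > 0" using decomposition_facts(5)[OF d(1)] prime prime_gt_0_nat by simp
  ultimately show False using d(3) eq by (simp add: pcompose_eq_0_iff)
qed

lemma degree_pderiv_decomposition:
  assumes d: "normal_decomposition f (g, h)"
  shows "degree (pderiv h) = degree (pderiv g)" "degree (pderiv f) = degree (pderiv g) * (p + 1)"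
proof -
  obtain gs hs where d': "normal_decomposition f (gs, hs)" "(gs, hs) \<noteq> (g, h)"
    using other_decomposition by blast
  note F = decomposition_facts[OF d] and F' = decomposition_facts[OF d'(1)]
  show e: "degree (pderiv h) = degree (pderiv g)"
    using collision_degrees(2)[OF prime CHAR F(1,2,4,5,6) F'(1,2,4,5,6) _ inner_neq[OF d d']] F(7) F'(7) deriv by simp
  show "degree (pderiv f) = degree (pderiv g) * (p + 1)"
    using degree_pderiv_pcompose[of g h] F(5,7) deriv e by simp
qed

lemma collision_ac:
  assumes d: "normal_decomposition f (g, h)" "normal_decomposition f (gs, hs)" "(gs, hs) \<noteq> (g, h)"
  shows "collision p (ac g) (ac h) (ac gs) (ac hs)"
proof
  note F = decomposition_facts[OF d(1)] and F' = decomposition_facts[OF d(2)]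
  show "CHAR('a alg_closure) = p" using CHAR by simp
  show "pcompose (ac g) (ac h) = pcompose (ac gs) (ac hs)"
    using F(7) F'(7) by (simp flip: ac_pcompose)
  show "pderiv (pcompose (ac g) (ac h)) \<noteq> 0"
    using F(7) deriv by (simp flip: ac_pcompose ac_pderiv)
  show "ac h \<noteq> ac hs" using inner_neq[OF d] by simp
qed (use prime decomposition_facts[OF d(1)] decomposition_facts[OF d(2)] in \<open>simp_all add: coeff_ac\<close>)

text \<open>Two fixed decompositions supply c, u, M and w. An arbitrary one collides with one of
  these two: the only critical value of \<open>f\<close> is c again, and u and M are read off the
  left component of that partner. So the same w satisfies the description for every
  decomposition.\<close>

lemma decomposition_profile:
  assumes ramified: "degree (pderiv f) > 0"
  shows "\<exists>u M w. u < M \<and> 0 < u \<and> (u \<noteq> 1 \<longrightarrow> p = u + M) \<and>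
    (\<forall>g h. normal_decomposition f (g, h) \<longrightarrow>
      (u = 1 \<longrightarrow> type_i (ac g) (poly (ac h) w) M \<and> type_i (ac h) w M) \<and>
      (u \<noteq> 1 \<longrightarrow> (\<exists>r\<in>{u, p - u}. type_ii p (ac g) (ac h) w r)))"
proof -
  have acf: "ac f = pcompose (ac g) (ac h)" if "normal_decomposition f (g, h)" for g h
    using decomposition_facts(7)[OF that] by (metis ac_pcompose)
  have matching: "\<exists>c u M b0 z0. matching_fibres (ac g) (ac gs) c u M b0 z0"
    if d: "normal_decomposition f (g, h)" "normal_decomposition f (gs, hs)" "(gs, hs) \<noteq> (g, h)" for g h gs hs
  proof -
    interpret collision p "ac g" "ac h" "ac gs" "ac hs" by (rule collision_ac[OF d])
    have "degree (pderiv g) > 0" using degree_pderiv_decomposition(2)[OF d(1)] ramified by (cases "degree (pderiv g)") auto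
    then have "degree (pderiv (ac g)) > 0" by (simp flip: ac_pderiv)
    then obtain b where "poly (pderiv (ac g)) b = 0"
      using alg_closed_imp_poly_has_root by blast
    then show ?thesis using matching_fibres_exist root_mult_gt_1_iff[OF at_g] by blast
  qed
  obtain d1 d2 where dd: "normal_decomposition f d1" "normal_decomposition f d2" "d2 \<noteq> d1"
    using ex_two by blast
  obtain g1 h1 g2 h2 where d12: "d1 = (g1, h1)" "d2 = (g2, h2)" by (metis prod.exhaust)
  note D = dd[unfolded d12]
  interpret C: collision p "ac g1" "ac h1" "ac g2" "ac h2" by (rule collision_ac[OF D])
  obtain c u M b0 z0 where mf: "matching_fibres (ac g1) (ac g2) c u M b0 z0"
    using matching[OF D] by blast
  have uM: "u < M" "0 < u" using mf by (auto simp: matching_fibres_def)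
  have pu: "p = u + M" if "u \<noteq> 1" using C.two_fibres[OF mf that] by metis
  have "\<exists>w. poly (ac f) w = c \<and> root_mult (ac f) w = (if u = 1 then 1 else u * M)"
    using C.ex_simple_point[OF mf] C.ex_double_point[OF mf] acf[OF D(1)] by auto
  then obtain w where w: "poly (ac f) w = c" "root_mult (ac f) w = (if u = 1 then 1 else u * M)" by blast
  have "(u = 1 \<longrightarrow> type_i (ac g) (poly (ac h) w) M \<and> type_i (ac h) w M) \<and>
      (u \<noteq> 1 \<longrightarrow> (\<exists>r\<in>{u, p - u}. type_ii p (ac g) (ac h) w r))"
    if d: "normal_decomposition f (g, h)" for g h
  proof -
    \<comment> \<open>The fixed decompositions are distinct, so at least one of them differs from
      (g, h) and serves as its partner.\<close>
    obtain g' h' where d': "normal_decomposition f (g', h')" "(g', h') \<noteq> (g, h)"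
      "(g', h') = (g1, h1) \<or> (g', h') = (g2, h2)"
      using D by metis
    interpret C': collision p "ac g" "ac h" "ac g'" "ac h'" by (rule collision_ac[OF d d'(1,2)])
    obtain c' u' M' b0' z0' where mf': "matching_fibres (ac g) (ac g') c' u' M' b0' z0'"
      using matching[OF d d'(1,2)] by blast
    obtain x where x: "1 < root_mult (ac f) x" using C.ex_critical_f[OF mf] acf[OF D(1)] by auto
    have "poly (ac f) x = c" using C.critical_f[OF mf] x acf[OF D(1)] by simp
    moreover have "poly (ac f) x = c'" using C'.critical_f[OF mf'] x acf[OF d] by simp
    ultimately have cc: "c' = c" by simp
    have "root_mult (ac g') ` {b. poly (ac g') b = c} = {u, M}"
      using d'(3) C.image_root_mult_g[OF mf] collision.image_root_mult_g[OF C.swap matching_fibres_swap[OF mf]] by auto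
    moreover have "root_mult (ac g') ` {b. poly (ac g') b = c'} = {u', M'}"
      by (rule collision.image_root_mult_g[OF C'.swap matching_fibres_swap[OF mf']])
    ultimately have "{u, M} = {u', M'}" using cc by simp
    \<comment> \<open>Both pairs are listed in increasing order, so equality as sets identifies
      them.\<close>
    moreover have "u' < M'" using mf' by (auto simp: matching_fibres_def)
    ultimately have uu: "u' = u" "M' = M" using uM by (auto simp: doubleton_eq_iff)
    note mf'' = mf'[unfolded cc uu]
    show ?thesis
      using C'.type_i_g_h[OF mf'' _ w(1)[unfolded acf[OF d]]] C'.type_ii_g_h[OF mf'' _ w(1)[unfolded acf[OF d]]]
        w(2)[unfolded acf[OF d]] by auto
  qed
  then show ?thesis using uM pu by blast
qed

end

theorem theorem4p5:
  fixes f :: "'a::field poly" and p :: nat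
  assumes char: "CHAR('a) = p" and char_pos: "p > 0"
    and normal: "normal_poly f" and deg: "degree f = p ^ 2" and deriv: "pderiv f \<noteq> 0"
    and collision: "\<exists>d e. normal_decomposition f d \<and> normal_decomposition f e \<and> d \<noteq> e"
  defines "case_i \<equiv>
      (\<exists>(w::'a) (m::nat). m > 0 \<and> m dvd p - 1 \<and>
        (\<forall>g h. normal_decomposition (shift_poly w f) (g, h) \<longrightarrow>
          (\<exists>a b. a \<noteq> 0 \<and> b \<noteq> 0 \<and>
            g = [:0, 1:] * ([:0, 1:] ^ ((p - 1) div m) - [:a:]) ^ m \<and>
            h = [:0, 1:] * ([:0, 1:] ^ ((p - 1) div m) - [:b:]) ^ m)))"
    and "case_ii \<equiv>
      (\<exists>(w::'a) (m::nat). 1 < m \<and> m < p - 1 \<and>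
        (\<forall>g h. normal_decomposition (shift_poly w f) (g, h) \<longrightarrow>
          (\<exists>r\<in>{m, p - m}. \<exists>a b. a \<noteq> 0 \<and> b \<noteq> 0 \<and>
            g = [:0, 1:] ^ r * ([:0, 1:] - [:a:]) ^ (p - r) \<and>
            (\<exists>q q'. squarefree q \<and> degree q = r \<and> squarefree q' \<and> degree q' = p - r \<and>
              h = [:0, 1:] ^ (p - r) * q \<and>
              h - [:a:] = ([:0, 1:] - [:b:]) ^ r * q'))))"
  shows "(case_i \<or> case_ii) \<and> \<not> (case_i \<and> case_ii)"
proof -
  have prime: "prime p" using prime_CHAR_semidom[where 'a='a] char char_pos by simp
  interpret normal_collision p f
    using prime char normal deg deriv collision by unfold_locales
  have pK: "prime p" "CHAR('a alg_closure) = p" using prime char by auto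
  obtain g1 h1 where D1: "normal_decomposition f (g1, h1)" using other_decomposition by blast
  have exclusive: "\<not> (case_i \<and> case_ii)"
  proof
    assume "case_i \<and> case_ii"
    then obtain w m w' m' where i: "m > 0" "m dvd p - 1"
      "\<And>g h. normal_decomposition (shift_poly w f) (g, h) \<Longrightarrow>
          \<exists>a b. a \<noteq> 0 \<and> b \<noteq> 0 \<and>
            g = [:0, 1:] * ([:0, 1:] ^ ((p - 1) div m) - [:a:]) ^ m \<and>
            h = [:0, 1:] * ([:0, 1:] ^ ((p - 1) div m) - [:b:]) ^ m"
      and ii: "1 < m'" "m' < p - 1"
      "\<And>g h. normal_decomposition (shift_poly w' f) (g, h) \<Longrightarrow>
          \<exists>r\<in>{m', p - m'}. \<exists>a b. a \<noteq> 0 \<and> b \<noteq> 0 \<and>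
            g = [:0, 1:] ^ r * ([:0, 1:] - [:a:]) ^ (p - r) \<and>
            (\<exists>q q'. squarefree q \<and> degree q = r \<and> squarefree q' \<and> degree q' = p - r \<and>
              h = [:0, 1:] ^ (p - r) * q \<and>
              h - [:a:] = ([:0, 1:] - [:b:]) ^ r * q')"
      unfolding case_i_def case_ii_def by blast
    obtain a where a: "a \<noteq> 0" "shift_poly (poly h1 w) g1 = [:0, 1:] * ([:0, 1:] ^ ((p - 1) div m) - [:a:]) ^ m"
      using i(3)[OF normal_decomposition_shift[OF D1]] by blast
    obtain r a' where r: "r \<in> {m', p - m'}" "a' \<noteq> 0"
      "shift_poly (poly h1 w') g1 = [:0, 1:] ^ r * ([:0, 1:] - [:a':]) ^ (p - r)"
      using ii(3)[OF normal_decomposition_shift[OF D1]] by blast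
    have "1 < r" "r < p - 1" using r(1) ii(1,2) by auto
    moreover have "m * ((p - 1) div m) = p - 1" using i(2) by simp
    ultimately show False using shapes_exclusive[OF prime char _ _ _ a(1) r(2) a(2) r(3)] by blast
  qed
  have "case_i \<or> case_ii"
  proof (cases "degree (pderiv f) = 0")
    case True
    \<comment> \<open>A constant derivative means that there is no critical point to single out a
      centre; w = 0 leaves \<open>f\<close> unchanged and m = 1 gives the additive shape.\<close>
    have f0: "shift_poly 0 f = f" using normal by (simp add: shift_poly_eq normal_poly_def poly_0_coeff_0)
    have "\<exists>a b. a \<noteq> 0 \<and> b \<noteq> 0 \<and> g = [:0, 1:] * ([:0, 1:] ^ ((p - 1) div 1) - [:a:]) ^ 1 \<and>
            h = [:0, 1:] * ([:0, 1:] ^ ((p - 1) div 1) - [:b:]) ^ 1"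
      if d: "normal_decomposition (shift_poly 0 f) (g, h)" for g h
    proof -
      note d = d[unfolded f0]
      note F = decomposition_facts[OF d]
      have "degree (pderiv g) = 0" "degree (pderiv h) = 0"
        using degree_pderiv_decomposition[OF d] True by auto
      then show ?thesis
        using additive_shape[OF prime char F(1,2,3,8)] additive_shape[OF prime char F(4,5,6,9)] by auto
    qed
    then have case_i unfolding case_i_def by (intro exI[of _ 0] exI[of _ 1]) auto
    then show ?thesis ..
  next
    case False
    then have "degree (pderiv f) > 0" by simp
    from decomposition_profile[OF this] obtain u M w where P: "u < M" "0 < u" "u \<noteq> 1 \<longrightarrow> p = u + M"
      and T: "\<forall>g h. normal_decomposition f (g, h) \<longrightarrow>
        (u = 1 \<longrightarrow> type_i (ac g) (poly (ac h) w) M \<and> type_i (ac h) w M) \<and>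
        (u \<noteq> 1 \<longrightarrow> (\<exists>r\<in>{u, p - u}. type_ii p (ac g) (ac h) w r))"
      by (elim exE conjE) (rule that)
    note T = T[THEN spec, THEN spec, THEN mp]
    show ?thesis
    proof (cases "u = 1")
      case True
      then have M: "1 < M" using P by simp
      have sh: "\<exists>a l. a \<noteq> 0 \<and> M * l = p - 1 \<and> shift_poly y (ac Q) = [:0, 1:] * ([:0, 1:] ^ l - [:a:]) ^ M"
        if "type_i (ac Q) y M" "lead_coeff Q = 1" "degree Q = p" "pderiv Q \<noteq> 0" for Q :: "'a poly" and y
        by (rule shift_poly_type_i[OF pK _ _ _ that(1) M]) (use that in \<open>simp_all add: coeff_ac flip: ac_pderiv\<close>)
      \<comment> \<open>The right component of a single decomposition suffices, since
        \<open>w\<close> is common to all of them.\<close>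
      have "w \<in> range to_ac"
        using sh[of h1 w] T[OF D1] True decomposition_facts[OF D1] shape_i_centre[OF prime char _ M] by blast
      then obtain w0 where w0: "w = to_ac w0" by blast
      have dec: "\<exists>a. a \<noteq> 0 \<and> M * ((p - 1) div M) = p - 1 \<and> shift_poly y Q = [:0, 1:] * ([:0, 1:] ^ ((p - 1) div M) - [:a:]) ^ M"
        if Q: "type_i (ac Q) (to_ac y) M" "lead_coeff Q = 1" "degree Q = p" "pderiv Q \<noteq> 0" for Q :: "'a poly" and y
      proof -
        obtain a l where al: "a \<noteq> 0" "M * l = p - 1" "ac (shift_poly y Q) = [:0, 1:] * ([:0, 1:] ^ l - [:a:]) ^ M"
          using sh[OF Q] by (auto simp: ac_shift_poly)
        have "l = (p - 1) div M" using al(2) M by (metis gr_implies_not0 nonzero_mult_div_cancel_left)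
        then show ?thesis using shape_i_descent[OF prime char al(2,1,3)] al(2) by metis
      qed
      have "\<exists>a b. a \<noteq> 0 \<and> b \<noteq> 0 \<and> g = [:0, 1:] * ([:0, 1:] ^ ((p - 1) div M) - [:a:]) ^ M \<and>
            h = [:0, 1:] * ([:0, 1:] ^ ((p - 1) div M) - [:b:]) ^ M"
        if d: "normal_decomposition (shift_poly w0 f) (g, h)" for g h
      proof -
        obtain g0 h0 where gh: "normal_decomposition f (g0, h0)" "g = shift_poly (poly h0 w0) g0" "h = shift_poly w0 h0"
          using normal_decomposition_unshift[OF normal d] by blast
        note F = decomposition_facts[OF gh(1)]
        have t: "type_i (ac g0) (to_ac (poly h0 w0)) M" "type_i (ac h0) (to_ac w0) M"
          using T[OF gh(1)] True by (auto simp: w0 poly_ac)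
        show ?thesis using dec[OF t(1) F(1,2,8)] dec[OF t(2) F(4,5,9)] gh by blast
      qed
      moreover have "M dvd p - 1"
        using sh[of h1 w] T[OF D1] True decomposition_facts[OF D1] by (metis dvd_triv_left)
      ultimately have case_i unfolding case_i_def using M by (intro exI[of _ w0] exI[of _ M]) auto
      then show ?thesis ..
    next
      case False
      have u: "1 < u" "u < p - 1" using P False by auto
      have desc: "\<exists>r\<in>{u, p - u}. \<exists>w0. w = to_ac w0 \<and> (\<exists>a b. a \<noteq> 0 \<and> b \<noteq> 0 \<and>
         shift_poly (poly h w0) g = [:0, 1:] ^ r * ([:0, 1:] - [:a:]) ^ (p - r) \<and>
         (\<exists>q q'. squarefree q \<and> degree q = r \<and> squarefree q' \<and> degree q' = p - r \<and>
          shift_poly w0 h = [:0, 1:] ^ (p - r) * q \<and>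
          shift_poly w0 h - [:a:] = ([:0, 1:] - [:b:]) ^ r * q'))"
        if d: "normal_decomposition f (g, h)" for g h
      proof -
        note F = decomposition_facts[OF d]
        obtain r where r: "r \<in> {u, p - u}" "type_ii p (ac g) (ac h) w r" using T[OF d] False by blast
        show ?thesis by (rule bexI[OF _ r(1)]) (rule type_ii_descent[OF prime char F(1,2,4,5,9) r(2)])
      qed
      obtain w0 where w0: "w = to_ac w0" using desc[OF D1] by blast
      have "\<exists>r\<in>{u, p - u}. \<exists>a b. a \<noteq> 0 \<and> b \<noteq> 0 \<and>
            g = [:0, 1:] ^ r * ([:0, 1:] - [:a:]) ^ (p - r) \<and>
            (\<exists>q q'. squarefree q \<and> degree q = r \<and> squarefree q' \<and> degree q' = p - r \<and>
              h = [:0, 1:] ^ (p - r) * q \<and>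
              h - [:a:] = ([:0, 1:] - [:b:]) ^ r * q')"
        if d: "normal_decomposition (shift_poly w0 f) (g, h)" for g h
      proof -
        obtain g0 h0 where gh: "normal_decomposition f (g0, h0)" "g = shift_poly (poly h0 w0) g0" "h = shift_poly w0 h0"
          using normal_decomposition_unshift[OF normal d] by blast
        show ?thesis using desc[OF gh(1)] unfolding w0 gh(2,3) to_ac_eq_iff by blast
      qed
      then have case_ii unfolding case_ii_def using u by (intro exI[of _ w0] exI[of _ u]) blast
      then show ?thesis ..
    qed
  qed
  then show ?thesis using exclusive ..
qed

end
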